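(* Let $n\ge p$, $\nu>0$, $\boldsymbol\eta=(\eta_1,\dots,\eta_p)\in\mathbb R^p$, and for $\boldsymbol d\in\mathbb R_+^p$ with $D=\mathrm{diag}(\boldsymbol d)$ set $$g(\boldsymbol d;\nu,\boldsymbol\eta)=\frac{\exp(\nu\,\boldsymbol\eta^T\boldsymbol d)}{\left[{}_0F_1\!\left(\tfrac n2,\tfrac{D^2}{4}\right)\right]^\nu}.$$ Then $\int_{\mathbb R_+^p}g(\boldsymbol d;\nu,\boldsymbol\eta)\,d\boldsymbol d<\infty$ if and only if $\max_{1\le j\le p}\eta_j<1$.
   Context: $\mathbb R_+^p=(0,\infty)^p$ with Lebesgue measure. $\mathcal V_{n,p}=\{X\in\mathbb R^{n\times p}:X^TX=I_p\}$ with normalized Haar probability measure $[dX]$; for diagonal $D$ with diagonal $\boldsymbol d$, ${}_0F_1\!\left(\tfrac n2,\tfrac{D^2}{4}\right)=\int_{\mathcal V_{n,p}}\exp\big(\sum_j d_jX_{jj}\big)[dX]$. *)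

theory Defs
  imports "HOL-Analysis.Analysis" "HOL-Probability.Probability"
begin

text \<open>Real n x p matrices are represented as extensional functions on
  index pairs (k,j) with k < n, j < p (0-based), i.e. elements of the product
  space below carrying the Borel product sigma-algebra.\<close>

definition mat_space :: "nat \<Rightarrow> nat \<Rightarrow> (nat \<times> nat \<Rightarrow> real) measure" where
  "mat_space n p = PiM ({..<n} \<times> {..<p}) (\<lambda>_. lborel)"

definition stiefel :: "nat \<Rightarrow> nat \<Rightarrow> (nat \<times> nat \<Rightarrow> real) set" where
  "stiefel n p = {X \<in> extensional ({..<n} \<times> {..<p}).
     \<forall>i<p. \<forall>j<p. (\<Sum>k<n. X (k,i) * X (k,j)) = (if i = j then 1 else 0)}"

definition orth_group :: "nat \<Rightarrow> (nat \<times> nat \<Rightarrow> real) set" where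
  "orth_group n = stiefel n n"

definition mat_lmult :: "nat \<Rightarrow> nat \<Rightarrow> (nat \<times> nat \<Rightarrow> real) \<Rightarrow> (nat \<times> nat \<Rightarrow> real) \<Rightarrow> (nat \<times> nat \<Rightarrow> real)" where
  "mat_lmult n p Q X = restrict (\<lambda>(k,j). \<Sum>l<n. Q (k,l) * X (l,j)) ({..<n} \<times> {..<p})"

definition haar_stiefel :: "nat \<Rightarrow> nat \<Rightarrow> (nat \<times> nat \<Rightarrow> real) measure" where
  "haar_stiefel n p = (THE \<mu>. sets \<mu> = sets (mat_space n p) \<and> prob_space \<mu> \<and>
       emeasure \<mu> (stiefel n p) = 1 \<and>
       (\<forall>Q\<in>orth_group n. distr \<mu> (mat_space n p) (mat_lmult n p Q) = \<mu>))"

text \<open>0F1(n/2, D^2/4) = integral over V_{n,p} of exp(sum_j d_j X_jj) [dX].\<close>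
definition hyp0F1_stiefel :: "nat \<Rightarrow> nat \<Rightarrow> (nat \<Rightarrow> real) \<Rightarrow> real" where
  "hyp0F1_stiefel n p d = (\<integral>X. exp (\<Sum>j<p. d j * X (j,j)) \<partial>haar_stiefel n p)"

definition g_dens :: "nat \<Rightarrow> nat \<Rightarrow> real \<Rightarrow> (nat \<Rightarrow> real) \<Rightarrow> (nat \<Rightarrow> real) \<Rightarrow> real" where
  "g_dens n p \<nu> \<eta> d = exp (\<nu> * (\<Sum>j<p. \<eta> j * d j)) / (hyp0F1_stiefel n p d) powr \<nu>"

definition pos_orthant :: "nat \<Rightarrow> (nat \<Rightarrow> real) set" where
  "pos_orthant p = PiE {..<p} (\<lambda>_. {0<..})"

end

theory Submission
  imports Defs "HOL-Real_Asymp.Real_Asymp"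
begin

text \<open>On the Stiefel manifold \<open>X\<^sub>j\<^sub>j \<le> 1\<close>, so \<open>\<^sub>0F\<^sub>1 \<le> exp (\<Sum>d\<^sub>j)\<close>; and for every \<open>\<epsilon> > 0\<close> the
  neighbourhood \<open>{X. \<forall>j. X\<^sub>j\<^sub>j > 1 - \<epsilon>}\<close> of the unit matrix has positive Haar mass \<open>c\<close>, so
  \<open>\<^sub>0F\<^sub>1 \<ge> c exp ((1 - \<epsilon>) \<Sum>d\<^sub>j)\<close>. The density is thus squeezed between exponentials of linear
  functions of \<open>d\<close>, whose integrals factor over the coordinates.

  The substance lies in showing that the Haar measure, given by a definite description, exists, is
  unique, and charges neighbourhoods of the unit matrix. Lebesgue measure on square matrices is
  invariant under the orthogonal group; normalised on a ball and pushed forward by Gram-Schmidt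
  orthogonalisation it becomes an invariant probability measure on the orthogonal group, from
  which uniqueness follows by a Fubini argument and transitivity of the action.\<close>

section \<open>Matrices and transitivity of the orthogonal action\<close>

lemma mat_lmult_apply:
  "k < n \<Longrightarrow> j < p \<Longrightarrow> mat_lmult n p Q X (k, j) = (\<Sum>l<n. Q (k, l) * X (l, j))"
  by (simp add: mat_lmult_def)

lemma mat_lmult_extensional [simp]: "mat_lmult n p Q X \<in> extensional ({..<n} \<times> {..<p})"
  by (simp add: mat_lmult_def)

lemma mat_eqI:
  assumes "X \<in> extensional ({..<n} \<times> {..<p})" "Y \<in> extensional ({..<n} \<times> {..<p})"
    and "\<And>i j. i < n \<Longrightarrow> j < p \<Longrightarrow> X (i, j) = Y (i, j)"
  shows "X = Y"
  using assms by (intro extensionalityI[of X "{..<n} \<times> {..<p}" Y]) auto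

lemma mat_lmult_assoc:
  "mat_lmult n p A (mat_lmult n p B X) = mat_lmult n p (mat_lmult n n A B) X"
proof (rule mat_eqI[of _ n p])
  fix i j assume ij: "i < n" "j < p"
  have "mat_lmult n p A (mat_lmult n p B X) (i, j) = (\<Sum>l<n. \<Sum>m<n. A (i, l) * B (l, m) * X (m, j))"
    using ij by (simp add: mat_lmult_apply sum_distrib_left mult.assoc)
  also have "\<dots> = (\<Sum>m<n. \<Sum>l<n. A (i, l) * B (l, m) * X (m, j))"
    by (rule sum.swap)
  also have "\<dots> = mat_lmult n p (mat_lmult n n A B) X (i, j)"
    using ij by (simp add: mat_lmult_apply sum_distrib_right)
  finally show "mat_lmult n p A (mat_lmult n p B X) (i, j) = mat_lmult n p (mat_lmult n n A B) X (i, j)" .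
qed auto

definition mat_unit :: "nat \<Rightarrow> nat \<Rightarrow> nat \<times> nat \<Rightarrow> real" where
  "mat_unit n p = restrict (\<lambda>(i, j). if i = j then 1 else 0) ({..<n} \<times> {..<p})"

definition mat_transpose :: "nat \<Rightarrow> (nat \<times> nat \<Rightarrow> real) \<Rightarrow> nat \<times> nat \<Rightarrow> real" where
  "mat_transpose n Q = restrict (\<lambda>(i, j). Q (j, i)) ({..<n} \<times> {..<n})"

lemma mat_unit_apply: "i < n \<Longrightarrow> j < p \<Longrightarrow> mat_unit n p (i, j) = (if i = j then 1 else 0)"
  by (simp add: mat_unit_def)

lemma mat_unit_extensional [simp]: "mat_unit n p \<in> extensional ({..<n} \<times> {..<p})"
  by (simp add: mat_unit_def)

lemma mat_transpose_apply: "i < n \<Longrightarrow> j < n \<Longrightarrow> mat_transpose n Q (i, j) = Q (j, i)"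
  by (simp add: mat_transpose_def)

lemma mat_transpose_extensional [simp]: "mat_transpose n Q \<in> extensional ({..<n} \<times> {..<n})"
  by (simp add: mat_transpose_def)

lemma mat_transpose_transpose:
  "Q \<in> extensional ({..<n} \<times> {..<n}) \<Longrightarrow> mat_transpose n (mat_transpose n Q) = Q"
  by (rule mat_eqI[of _ n n]) (auto simp: mat_transpose_apply)

lemma mat_transpose_mult:
  "mat_transpose n (mat_lmult n n A B) = mat_lmult n n (mat_transpose n B) (mat_transpose n A)"
  by (rule mat_eqI[of _ n n]) (auto simp: mat_transpose_apply mat_lmult_apply mult.commute)

lemma mat_lmult_unit_right:
  assumes "p \<le> n" "i < n" "j < p"
  shows "mat_lmult n p Q (mat_unit n p) (i, j) = Q (i, j)"
proof -
  have "mat_lmult n p Q (mat_unit n p) (i, j) = (\<Sum>l<n. if l = j then Q (i, l) else 0)"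
    unfolding mat_lmult_apply[OF assms(2,3)] using assms by (intro sum.cong) (auto simp: mat_unit_apply)
  then show ?thesis using assms by simp
qed

lemma mat_lmult_unit_left:
  assumes "X \<in> extensional ({..<n} \<times> {..<p})"
  shows "mat_lmult n p (mat_unit n n) X = X"
proof (rule mat_eqI[of _ n p])
  fix i j assume ij: "i < n" "j < p"
  have "mat_lmult n p (mat_unit n n) X (i, j) = (\<Sum>l<n. if i = l then X (l, j) else 0)"
    unfolding mat_lmult_apply[OF ij] using ij by (intro sum.cong) (auto simp: mat_unit_apply)
  then show "mat_lmult n p (mat_unit n n) X (i, j) = X (i, j)" using ij by simp
qed (use assms in auto)

section \<open>Inner products of columns, reflections and transitivity of the action\<close>

definition col_inner :: "nat \<Rightarrow> (nat \<times> nat \<Rightarrow> real) \<Rightarrow> nat \<Rightarrow> nat \<Rightarrow> real" where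
  "col_inner n X a b = (\<Sum>k<n. X (k, a) * X (k, b))"

lemma stiefel_iff:
  "X \<in> stiefel n p \<longleftrightarrow> X \<in> extensional ({..<n} \<times> {..<p}) \<and>
     (\<forall>i<p. \<forall>j<p. col_inner n X i j = (if i = j then 1 else 0))"
  by (simp add: stiefel_def col_inner_def)

text \<open>The defining equations of \<open>stiefel n n\<close> are the entries of the identity Q^T
  Q = I. In this form they combine with \<open>mat_lmult_assoc\<close>. The other identity, Q Q^T =
  I, becomes available only through \<open>orth_group_transpose\<close>.\<close>

lemma orth_group_iff:
  "Q \<in> orth_group n \<longleftrightarrow> Q \<in> extensional ({..<n} \<times> {..<n}) \<and>
     mat_lmult n n (mat_transpose n Q) Q = mat_unit n n"
proof -
  have "mat_lmult n n (mat_transpose n Q) Q = mat_unit n n \<longleftrightarrow>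
      (\<forall>i<n. \<forall>j<n. mat_lmult n n (mat_transpose n Q) Q (i, j) = mat_unit n n (i, j))"
    using mat_eqI[of "mat_lmult n n (mat_transpose n Q) Q" n n "mat_unit n n"] by auto
  then show ?thesis
    by (simp add: orth_group_def stiefel_def mat_lmult_apply mat_transpose_apply mat_unit_apply)
qed

text \<open>After the two products are expanded and the sums reordered, the sum of
  \<open>Q (k, l) * Q (k, m)\<close> over k collapses to the Kronecker delta. The invariance of the
  Stiefel manifold, of \<open>mat_ball\<close> and of the Gram-Schmidt coefficients all rest on
  this.\<close>

lemma col_inner_lmult:
  assumes Q: "Q \<in> orth_group n" and "a < p" "b < p"
  shows "col_inner n (mat_lmult n p Q X) a b = col_inner n X a b"
proof -
  have "col_inner n (mat_lmult n p Q X) a b =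
      (\<Sum>k<n. \<Sum>l<n. \<Sum>m<n. (Q (k, l) * Q (k, m)) * (X (l, a) * X (m, b)))"
    using assms by (simp add: col_inner_def mat_lmult_apply sum_product mult_ac)
  also have "\<dots> = (\<Sum>l<n. \<Sum>k<n. \<Sum>m<n. (Q (k, l) * Q (k, m)) * (X (l, a) * X (m, b)))"
    by (rule sum.swap)
  also have "\<dots> = (\<Sum>l<n. \<Sum>m<n. \<Sum>k<n. (Q (k, l) * Q (k, m)) * (X (l, a) * X (m, b)))"
    by (intro sum.cong refl sum.swap)
  also have "\<dots> = (\<Sum>l<n. \<Sum>m<n. if l = m then X (l, a) * X (m, b) else 0)"
    using Q by (intro sum.cong refl)
      (simp add: sum_distrib_right[symmetric] orth_group_def stiefel_def)
  also have "\<dots> = col_inner n X a b"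
    by (simp add: col_inner_def)
  finally show ?thesis .
qed

lemma stiefel_lmult:
  assumes "Q \<in> orth_group n" "X \<in> stiefel n p"
  shows "mat_lmult n p Q X \<in> stiefel n p"
  using assms by (simp add: stiefel_iff col_inner_lmult)

lemma orth_group_lmult:
  "Q \<in> orth_group n \<Longrightarrow> R \<in> orth_group n \<Longrightarrow> mat_lmult n n Q R \<in> orth_group n"
  using stiefel_lmult[of Q n R n] by (simp add: orth_group_def)

lemma mat_unit_stiefel:
  assumes "p \<le> n" shows "mat_unit n p \<in> stiefel n p"
proof -
  have "col_inner n (mat_unit n p) i j = (if i = j then 1 else 0)" if "i < p" "j < p" for i j
  proof -
    have "col_inner n (mat_unit n p) i j = (\<Sum>k<n. if k = i then (if i = j then 1 else 0) else 0)"
      unfolding col_inner_def using that by (intro sum.cong) (auto simp: mat_unit_apply)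
    then show ?thesis using that assms by simp
  qed
  then show ?thesis by (simp add: stiefel_iff)
qed

text \<open>For \<open>v = 0\<close> the junk value \<open>x / 0 = 0\<close> turns the reflection into the identity, so no
  case distinction is needed below.\<close>

definition householder :: "nat \<Rightarrow> (nat \<Rightarrow> real) \<Rightarrow> nat \<times> nat \<Rightarrow> real" where
  "householder n v = restrict (\<lambda>(i, j). (if i = j then 1 else 0) - 2 / (\<Sum>k<n. v k * v k) * v i * v j)
     ({..<n} \<times> {..<n})"

lemma householder_apply:
  "i < n \<Longrightarrow> j < n \<Longrightarrow>
    householder n v (i, j) = (if i = j then 1 else 0) - 2 / (\<Sum>k<n. v k * v k) * v i * v j"
  by (simp add: householder_def)

lemma householder_lmult_apply:
  assumes "i < n" "j < p"
  shows "mat_lmult n p (householder n v) X (i, j) =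
    X (i, j) - 2 / (\<Sum>k<n. v k * v k) * v i * (\<Sum>k<n. v k * X (k, j))"
proof -
  have "mat_lmult n p (householder n v) X (i, j) =
      (\<Sum>l<n. (if i = l then X (l, j) else 0) - 2 / (\<Sum>k<n. v k * v k) * v i * (v l * X (l, j)))"
    using assms by (auto simp: mat_lmult_apply householder_apply algebra_simps intro!: sum.cong)
  also have "\<dots> = X (i, j) - 2 / (\<Sum>k<n. v k * v k) * v i * (\<Sum>k<n. v k * X (k, j))"
    using assms by (simp add: sum_subtractf sum_distrib_left)
  finally show ?thesis .
qed

lemma householder_transpose: "mat_transpose n (householder n v) = householder n v"
  by (rule mat_eqI[of _ n n]) (auto simp: mat_transpose_apply householder_apply householder_def)

text \<open>A reflection is symmetric and an involution, so its transpose inverts it.\<close>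

lemma householder_orth: "householder n v \<in> orth_group n"
proof -
  have "mat_lmult n n (householder n v) (householder n v) = mat_unit n n"
  proof (rule mat_eqI[of _ n n])
    fix i j assume ij: "i < n" "j < n"
    define s where "s = (\<Sum>k<n. v k * v k)"
    have "(\<Sum>k<n. v k * householder n v (k, j)) =
        (\<Sum>k<n. (if k = j then v k else 0) - 2 / s * v j * (v k * v k))"
      using ij by (intro sum.cong) (auto simp: householder_apply s_def[symmetric] algebra_simps)
    also have "\<dots> = v j - 2 / s * v j * s"
      using ij unfolding sum_subtractf sum_distrib_left[symmetric] s_def[symmetric] by simp
    finally have *: "(\<Sum>k<n. v k * householder n v (k, j)) = v j - 2 / s * v j * s" .
    show "mat_lmult n n (householder n v) (householder n v) (i, j) = mat_unit n n (i, j)"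
      using ij unfolding householder_lmult_apply[OF ij] *
      by (cases "s = 0") (auto simp: mat_unit_apply householder_apply s_def[symmetric] field_simps)
  qed auto
  then show ?thesis
    by (simp add: orth_group_iff householder_transpose) (simp add: householder_def)
qed

text \<open>Reflection in v = x - e swaps two unit vectors x and e: with t the inner product of e
  and x, the squared length of v is 2 - 2t and the inner product of v and x is 1 - t, so exactly v
  is subtracted from x.\<close>

lemma householder_exchange:
  fixes n i :: nat
  assumes "\<And>i. i < n \<Longrightarrow> v i = x i - (e i :: real)"
    and "(\<Sum>k<n. x k * x k) = 1" "(\<Sum>k<n. e k * e k) = 1" and "i < n"
  shows "x i - 2 / (\<Sum>k<n. v k * v k) * v i * (\<Sum>k<n. v k * x k) = e i"
proof -
  define t where "t = (\<Sum>k<n. e k * x k)"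
  have vx: "(\<Sum>k<n. v k * x k) = 1 - t"
    using assms(2) by (simp add: assms(1) left_diff_distrib sum_subtractf t_def)
  have vv: "(\<Sum>k<n. v k * v k) = 2 - 2 * t"
    using assms(2,3)
    by (simp add: assms(1) left_diff_distrib right_diff_distrib sum_subtractf sum.distrib
        sum_distrib_left[symmetric] t_def mult.commute)
  show ?thesis
  \<comment> \<open>If t = 1, then v vanishes and x already equals e; the quotient is a division by
    zero, so this case cannot be reached by cancelling 1 - t.\<close>
  proof (cases "t = 1")
    case True
    then have "(\<Sum>k<n. v k * v k) = 0" using vv by simp
    then have "v i * v i = 0"
      using sum_nonneg_eq_0_iff[of "{..<n}" "\<lambda>k. v k * v k"] \<open>i < n\<close> by simp
    then show ?thesis using assms by simp
  next
    case False
    then have "2 / (2 - 2 * t) * v i * (1 - t) = v i" by (simp add: field_simps)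
    then show ?thesis using assms(1)[OF \<open>i < n\<close>] by (simp add: vx vv)
  qed
qed

text \<open>Induction on the number of columns already carried to standard unit vectors, with one
  reflection for each further column. Orthogonality of the transpose is carried along because
  closure under transposition is itself deduced from this lemma; reflections are symmetric and
  products reverse, so it survives each step.\<close>

lemma stiefel_to_unit_columns:
  assumes X: "X \<in> stiefel n p" and "p \<le> n" "m \<le> p"
  shows "\<exists>H. H \<in> orth_group n \<and> mat_transpose n H \<in> orth_group n \<and>
    (\<forall>j<m. \<forall>i<n. mat_lmult n p H X (i, j) = (if i = j then 1 else 0))"
  using \<open>m \<le> p\<close>
proof (induction m)
  case 0
  have "mat_transpose n (mat_unit n n) = mat_unit n n"
    by (rule mat_eqI[of _ n n]) (auto simp: mat_transpose_apply mat_unit_apply)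
  with mat_unit_stiefel[of n n] show ?case
    by (intro exI[of _ "mat_unit n n"]) (auto simp: orth_group_def)
next
  case (Suc m)
  then obtain H where H: "H \<in> orth_group n" "mat_transpose n H \<in> orth_group n"
    and Hcol: "\<And>i j. j < m \<Longrightarrow> i < n \<Longrightarrow> mat_lmult n p H X (i, j) = (if i = j then 1 else 0)"
    by auto
  define Y where "Y = mat_lmult n p H X"
  have Y: "Y \<in> stiefel n p"
    using stiefel_lmult[OF H(1) X] by (simp add: Y_def)
  have m: "m < p" "m < n" using Suc.prems \<open>p \<le> n\<close> by auto
  define v where "v i = Y (i, m) - (if i = m then 1 else 0)" for i
  let ?R = "householder n v"
  have "mat_lmult n p ?R Y (i, j) = (if i = j then 1 else 0)" if "j < Suc m" "i < n" for i j
  proof (cases "j = m")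
    case True
    have "(\<Sum>k<n. Y (k, m) * Y (k, m)) = 1"
      using Y m by (simp add: stiefel_def)
    moreover have "(\<Sum>k<n. (if k = m then 1 else 0) * (if k = m then 1 else 0)) = (1::real)"
      using m by (simp add: if_distrib[of "\<lambda>x. x * _"] cong: if_cong)
    ultimately show ?thesis
      using householder_exchange[of n v "\<lambda>i. Y (i, m)" "\<lambda>i. if i = m then 1 else 0" i]
        that m True by (simp add: householder_lmult_apply v_def)
  next
    case False
    then have jm: "j < m" using that by simp
    have Yj: "Y (k, j) = (if k = j then 1 else 0)" if "k < n" for k
      using Hcol[OF jm that] by (simp add: Y_def)
    have "(\<Sum>k<n. v k * Y (k, j)) = v j"
    proof -
      have "(\<Sum>k<n. v k * Y (k, j)) = (\<Sum>k<n. if k = j then v k else 0)"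
        by (intro sum.cong) (auto simp: Yj)
      then show ?thesis using jm m by simp
    qed
    \<comment> \<open>Column m is orthogonal to column j, which is already the j-th unit vector, so
      the new reflection fixes the earlier columns.\<close>
    moreover have "v j = 0"
    proof -
      have "0 = (\<Sum>k<n. Y (k, m) * Y (k, j))"
        using Y jm m by (auto simp: stiefel_def)
      also have "\<dots> = (\<Sum>k<n. if k = j then Y (k, m) else 0)"
        by (intro sum.cong) (auto simp: Yj)
      finally show ?thesis using jm m by (simp add: v_def)
    qed
    ultimately show ?thesis
      using that jm m Yj by (simp add: householder_lmult_apply)
  qed
  then show ?case
    using H householder_orth[of n v]
    by (intro exI[of _ "mat_lmult n n ?R H"])
      (auto simp: mat_lmult_assoc[symmetric] Y_def mat_transpose_mult householder_transpose
        intro!: orth_group_lmult)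
qed

lemma stiefel_transitive:
  assumes X: "X \<in> stiefel n p" and "p \<le> n"
  obtains H where "H \<in> orth_group n" "mat_transpose n H \<in> orth_group n"
    "X = mat_lmult n p H (mat_unit n p)"
proof -
  obtain H where H: "H \<in> orth_group n" "mat_transpose n H \<in> orth_group n"
    and Hcol: "\<forall>j<p. \<forall>i<n. mat_lmult n p H X (i, j) = (if i = j then 1 else 0)"
    using stiefel_to_unit_columns[OF X \<open>p \<le> n\<close> order_refl] by blast
  have Xe: "X \<in> extensional ({..<n} \<times> {..<p})" using X by (simp add: stiefel_def)
  have "mat_lmult n p H X = mat_unit n p"
    by (rule mat_eqI[of _ n p]) (use Hcol in \<open>auto simp: mat_unit_apply\<close>)
  then have "mat_lmult n p (mat_transpose n H) (mat_unit n p) = X"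
    using H mat_lmult_assoc[of n p "mat_transpose n H" H X]
    by (simp add: orth_group_iff mat_lmult_unit_left[OF Xe])
  moreover have "mat_transpose n (mat_transpose n H) = H"
    using H by (simp add: orth_group_iff mat_transpose_transpose)
  ultimately show thesis using H by (intro that[of "mat_transpose n H"]) auto
qed

text \<open>Transitivity in the square case writes Q as H times the unit matrix, where H has an
  orthogonal transpose by construction. This replaces the dimension argument that a one-sided
  inverse of a square matrix is two-sided.\<close>

lemma orth_group_transpose:
  assumes "Q \<in> orth_group n" shows "mat_transpose n Q \<in> orth_group n"
proof -
  obtain H where H: "mat_transpose n H \<in> orth_group n" "H \<in> orth_group n"
    and Q: "Q = mat_lmult n n H (mat_unit n n)"
    using assms stiefel_transitive[of Q n n] by (auto simp: orth_group_def)
  have "Q = H"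
    by (rule mat_eqI[of _ n n]) (use assms H Q mat_lmult_unit_right[of n n] in \<open>auto simp: orth_group_iff\<close>)
  with H show ?thesis by simp
qed

lemma orth_group_transpose_cancel:
  assumes "Q \<in> orth_group n" "X \<in> extensional ({..<n} \<times> {..<p})"
  shows "mat_lmult n p Q (mat_lmult n p (mat_transpose n Q) X) = X"
  using orth_group_transpose[OF assms(1)] assms
  by (simp add: mat_lmult_assoc orth_group_iff mat_transpose_transpose mat_lmult_unit_left)

section \<open>Invariance of Lebesgue measure\<close>

interpretation lborel_product: product_sigma_finite "\<lambda>_. lborel :: real measure" ..

text \<open>A product measure is determined by its values on boxes, and there the translation acts
  on each coordinate separately.\<close>

lemma distr_PiM_lborel_plus:
  fixes z :: "'i \<Rightarrow> real"
  assumes "finite I"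
  shows "distr (PiM I (\<lambda>_. lborel)) (PiM I (\<lambda>_. lborel)) (\<lambda>x. \<lambda>i\<in>I. x i + z i) =
    PiM I (\<lambda>_. lborel :: real measure)"
proof (rule lborel_product.PiM_eqI)
  fix A :: "'i \<Rightarrow> real set" assume A: "\<And>i. i \<in> I \<Longrightarrow> A i \<in> sets lborel"
  let ?L = "PiM I (\<lambda>_. lborel :: real measure)"
  have m: "(\<lambda>x. \<lambda>i\<in>I. x i + z i) \<in> measurable ?L ?L"
    by measurable
  have "emeasure (distr ?L ?L (\<lambda>x. \<lambda>i\<in>I. x i + z i)) (PiE I A) =
      emeasure ?L ((\<lambda>x. \<lambda>i\<in>I. x i + z i) -` PiE I A \<inter> space ?L)"
    using A assms by (intro emeasure_distr m sets_PiM_I_finite) auto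
  also have "(\<lambda>x. \<lambda>i\<in>I. x i + z i) -` PiE I A \<inter> space ?L = PiE I (\<lambda>i. (+) (z i) -` A i)"
    by (auto simp: space_PiM PiE_iff add.commute)
  also have "emeasure ?L \<dots> = (\<Prod>i\<in>I. emeasure lborel ((+) (z i) -` A i))"
    using A assms by (intro lborel_product.emeasure_PiM) (auto intro: measurable_sets_borel[of _ borel])
  also have "\<dots> = (\<Prod>i\<in>I. emeasure lborel (A i))"
  proof (rule prod.cong)
    fix i assume "i \<in> I"
    have "emeasure lborel (A i) = emeasure (distr lborel borel ((+) (z i))) (A i)"
      by (simp add: lborel_distr_plus)
    also have "\<dots> = emeasure lborel ((+) (z i) -` A i)"
      using A[OF \<open>i \<in> I\<close>] by (subst emeasure_distr) auto
    finally show "emeasure lborel ((+) (z i) -` A i) = emeasure lborel (A i)" ..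
  qed simp
  finally show "emeasure (distr ?L ?L (\<lambda>x. \<lambda>i\<in>I. x i + z i)) (PiE I A) =
      (\<Prod>i\<in>I. emeasure lborel (A i))" .
qed (use assms in auto)

lemma nn_integral_PiM_lborel_plus:
  fixes z :: "'i \<Rightarrow> real"
  assumes "finite I" and [measurable]: "f \<in> borel_measurable (PiM I (\<lambda>_. lborel))"
  shows "(\<integral>\<^sup>+x. f (\<lambda>i\<in>I. x i + z i) \<partial>PiM I (\<lambda>_. lborel)) = (\<integral>\<^sup>+x. f x \<partial>PiM I (\<lambda>_. lborel))"
proof -
  have "(\<integral>\<^sup>+x. f x \<partial>PiM I (\<lambda>_. lborel)) =
      (\<integral>\<^sup>+x. f x \<partial>distr (PiM I (\<lambda>_. lborel)) (PiM I (\<lambda>_. lborel)) (\<lambda>x. \<lambda>i\<in>I. x i + z i))"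
    using assms(1) by (simp add: distr_PiM_lborel_plus)
  also have "\<dots> = (\<integral>\<^sup>+x. f (\<lambda>i\<in>I. x i + z i) \<partial>PiM I (\<lambda>_. lborel))"
    by (rule nn_integral_distr) measurable
  finally show ?thesis ..
qed

text \<open>The uniqueness argument for translation invariant measures: evaluate
  \<open>\<integral>\<integral> 1\<^sub>A (T x) 1\<^sub>B (y)\<close> by first shifting \<open>y\<close> by \<open>T x\<close> and then \<open>x\<close> by \<open>T\<inverse> y\<close>. The set
  \<open>B\<close>, preserved by \<open>T\<close>, shows that the scaling factor is \<open>1\<close>.\<close>

lemma distr_PiM_lborel_additive:
  fixes T T' :: "('i \<Rightarrow> real) \<Rightarrow> 'i \<Rightarrow> real" and I :: "'i set"
  defines "L \<equiv> PiM I (\<lambda>_. lborel :: real measure)"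
  assumes "finite I"
    and T [measurable]: "T \<in> measurable L L" and T': "\<And>x. x \<in> extensional I \<Longrightarrow> T' x \<in> extensional I"
    and add: "\<And>x y. x \<in> extensional I \<Longrightarrow> y \<in> extensional I \<Longrightarrow>
      T (\<lambda>i\<in>I. x i + y i) = (\<lambda>i\<in>I. T x i + T y i)"
    and TT': "\<And>x. x \<in> extensional I \<Longrightarrow> T (T' x) = x"
    and B [measurable]: "B \<in> sets L" and TB: "\<And>x. x \<in> extensional I \<Longrightarrow> T x \<in> B \<longleftrightarrow> x \<in> B"
    and B_sym: "\<And>x. x \<in> extensional I \<Longrightarrow> (\<lambda>i\<in>I. - x i) \<in> B \<longleftrightarrow> x \<in> B"
    and B_pos: "emeasure L B \<noteq> 0" and B_fin: "emeasure L B \<noteq> \<infinity>"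
  shows "distr L L T = L"
proof (rule measure_eqI)
  fix A assume "A \<in> sets (distr L L T)"
  then have A [measurable]: "A \<in> sets L" by simp
  interpret L: sigma_finite_measure L
    unfolding L_def using lborel_product.sigma_finite[OF \<open>finite I\<close>] .
  interpret LL: pair_sigma_finite L L ..
  have sp: "space L = extensional I" by (simp add: L_def space_PiM PiE_def)
  have shift: "(\<integral>\<^sup>+x. f (\<lambda>i\<in>I. x i + z i) \<partial>L) = (\<integral>\<^sup>+x. f x \<partial>L)"
    if "f \<in> borel_measurable L" for f and z :: "'i \<Rightarrow> real"
    using nn_integral_PiM_lborel_plus[OF \<open>finite I\<close>, of f z] that by (simp add: L_def)
  have comp [measurable]: "(\<lambda>x. x i) \<in> measurable L borel" if "i \<in> I" for i
    using measurable_component_singleton[OF that, of "\<lambda>_. lborel :: real measure"] by (simp add: L_def)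
  have T_comp: "(\<lambda>x. T x i) \<in> measurable L borel" if "i \<in> I" for i
    using measurable_compose[OF T comp[OF that]] .
  have diff [measurable]: "(\<lambda>(x, y). \<lambda>i\<in>I. y i - T x i) \<in> measurable (L \<Otimes>\<^sub>M L) L"
    and plus [measurable]: "(\<lambda>(y, x). \<lambda>i\<in>I. T x i + y i) \<in> measurable (L \<Otimes>\<^sub>M L) L"
    unfolding split_beta
    by (subst (3) L_def, rule measurable_restrict, use T_comp comp in measurable)+
  have "emeasure (distr L L T) A * emeasure L B =
      (\<integral>\<^sup>+x. indicator A (T x) * (\<integral>\<^sup>+y. indicator B y \<partial>L) \<partial>L)"
  proof -
    have "emeasure (distr L L T) A = (\<integral>\<^sup>+x. indicator A (T x) \<partial>L)"
      by (subst nn_integral_distr[symmetric, OF T]) auto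
    then show ?thesis by (simp add: nn_integral_multc)
  qed
  also have "\<dots> = (\<integral>\<^sup>+x. indicator A (T x) * (\<integral>\<^sup>+y. indicator B (\<lambda>i\<in>I. y i - T x i) \<partial>L) \<partial>L)"
    using shift[of "indicator B" "\<lambda>i. - T x i" for x] by simp
  also have "\<dots> = (\<integral>\<^sup>+x. \<integral>\<^sup>+y. indicator A (T x) * indicator B (\<lambda>i\<in>I. y i - T x i) \<partial>L \<partial>L)"
    by (intro nn_integral_cong nn_integral_cmult[symmetric])
       (use measurable_compose[OF measurable_Pair1' diff] in \<open>simp add: borel_measurable_indicator'\<close>)
  also have "\<dots> = (\<integral>\<^sup>+y. \<integral>\<^sup>+x. indicator A (T x) * indicator B (\<lambda>i\<in>I. y i - T x i) \<partial>L \<partial>L)"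
    by (rule LL.Fubini'[symmetric]) (use diff in measurable)
  also have "\<dots> = (\<integral>\<^sup>+y. \<integral>\<^sup>+x. indicator A (\<lambda>i\<in>I. T x i + y i) * indicator B x \<partial>L \<partial>L)"
  proof (rule nn_integral_cong)
    fix y assume "y \<in> space L"
    then have y: "y \<in> extensional I" by (simp add: sp)
    have T_ext: "T x \<in> extensional I" if "x \<in> extensional I" for x
      using measurable_space[OF T, of x] that by (simp add: sp)
    have "(\<integral>\<^sup>+x. indicator A (T x) * indicator B (\<lambda>i\<in>I. y i - T x i) \<partial>L) =
        (\<integral>\<^sup>+x. indicator A (T (\<lambda>i\<in>I. x i + T' y i)) *
          indicator B (\<lambda>i\<in>I. y i - T (\<lambda>i\<in>I. x i + T' y i) i) \<partial>L)"
      by (rule shift[symmetric])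
         (use measurable_compose[OF measurable_Pair2' diff, of y] \<open>y \<in> space L\<close> in
           \<open>simp add: borel_measurable_indicator'\<close>)
    also have "\<dots> = (\<integral>\<^sup>+x. indicator A (\<lambda>i\<in>I. T x i + y i) * indicator B x \<partial>L)"
    proof (rule nn_integral_cong)
      fix x assume "x \<in> space L"
      then have x: "x \<in> extensional I" by (simp add: sp)
      have "T (\<lambda>i\<in>I. x i + T' y i) = (\<lambda>i\<in>I. T x i + y i)"
        using add[OF x T'[OF y]] TT'[OF y] by simp
      \<comment> \<open>After the shift, \<open>y\<close> cancels and the argument of the second
        indicator is \<open>- T x\<close>. Symmetry of \<open>B\<close> under negation and its
        invariance under \<open>T\<close> turn membership of this point into membership of
        \<open>x\<close>.\<close>
      moreover have "(\<lambda>i\<in>I. y i - (\<lambda>i\<in>I. T x i + y i) i) = (\<lambda>i\<in>I. - T x i)"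
        by auto
      ultimately show "indicator A (T (\<lambda>i\<in>I. x i + T' y i)) *
          indicator B (\<lambda>i\<in>I. y i - T (\<lambda>i\<in>I. x i + T' y i) i) =
          (indicator A (\<lambda>i\<in>I. T x i + y i) * indicator B x :: ennreal)"
        using B_sym[OF T_ext[OF x]] TB[OF x] by (simp add: indicator_def)
    qed
    finally show "(\<integral>\<^sup>+x. indicator A (T x) * indicator B (\<lambda>i\<in>I. y i - T x i) \<partial>L) =
        (\<integral>\<^sup>+x. indicator A (\<lambda>i\<in>I. T x i + y i) * indicator B x \<partial>L)" .
  qed
  also have "\<dots> = (\<integral>\<^sup>+x. \<integral>\<^sup>+y. indicator A (\<lambda>i\<in>I. T x i + y i) * indicator B x \<partial>L \<partial>L)"
    by (rule LL.Fubini') (use plus in measurable)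
  also have "\<dots> = (\<integral>\<^sup>+x. emeasure L A * indicator B x \<partial>L)"
  proof (rule nn_integral_cong)
    fix x
    have "(\<integral>\<^sup>+y. indicator A (\<lambda>i\<in>I. T x i + y i) * indicator B x \<partial>L) =
        (\<integral>\<^sup>+y. indicator A (\<lambda>i\<in>I. y i + T x i) * indicator B x \<partial>L)"
      by (simp add: add.commute)
    also have "\<dots> = (\<integral>\<^sup>+y. indicator A y * indicator B x \<partial>L)"
      by (rule shift[of "\<lambda>y. indicator A y * indicator B x"]) measurable
    also have "\<dots> = emeasure L A * indicator B x"
      by (simp add: nn_integral_multc)
    finally show "(\<integral>\<^sup>+y. indicator A (\<lambda>i\<in>I. T x i + y i) * indicator B x \<partial>L) =
        emeasure L A * indicator B x" .
  qed
  also have "\<dots> = emeasure L A * emeasure L B"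
    by (simp add: nn_integral_cmult)
  \<comment> \<open>The common factor \<open>emeasure L B\<close> can be cancelled since it is
    neither zero nor infinite.\<close>
  finally show "emeasure (distr L L T) A = emeasure L A"
    using B_pos B_fin by (simp add: mult.commute[of _ "emeasure L B"] ennreal_mult_cancel_left)
qed simp

section \<open>Measurability on the matrix space, and the volume of balls and boxes\<close>

lemma space_mat_space: "space (mat_space n p) = extensional ({..<n} \<times> {..<p})"
  by (simp add: mat_space_def space_PiM PiE_def)

lemma measurable_mat_entry [measurable]:
  "i < n \<Longrightarrow> j < p \<Longrightarrow> (\<lambda>X. X (i, j)) \<in> borel_measurable (mat_space n p)"
  using measurable_component_singleton[of "(i, j)" "{..<n} \<times> {..<p}" "\<lambda>_. lborel :: real measure"]
  by (simp add: mat_space_def)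

lemma measurable_into_mat_space:
  assumes "\<And>i j. i < n \<Longrightarrow> j < p \<Longrightarrow> (\<lambda>x. f x (i, j)) \<in> borel_measurable M"
    and "\<And>x. f x \<in> extensional ({..<n} \<times> {..<p})"
  shows "f \<in> measurable M (mat_space n p)"
proof -
  have "f = (\<lambda>x. restrict (f x) ({..<n} \<times> {..<p}))"
    using assms(2) by (simp add: extensional_restrict)
  moreover have "(\<lambda>x. restrict (f x) ({..<n} \<times> {..<p})) \<in> measurable M (mat_space n p)"
    unfolding mat_space_def by (rule measurable_restrict) (use assms(1) in auto)
  ultimately show ?thesis by simp
qed

lemma measurable_mat_lmult [measurable]:
  "mat_lmult n p Q \<in> measurable (mat_space n p) (mat_space n p)"
  by (rule measurable_into_mat_space) (auto simp: mat_lmult_apply)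

lemma measurable_col_inner [measurable]:
  "a < p \<Longrightarrow> b < p \<Longrightarrow> (\<lambda>X. col_inner n X a b) \<in> borel_measurable (mat_space n p)"
  unfolding col_inner_def by measurable

lemma sets_stiefel [measurable]: "stiefel n p \<in> sets (mat_space n p)"
proof -
  have "stiefel n p = {X \<in> space (mat_space n p).
      \<forall>i\<in>{..<p}. \<forall>j\<in>{..<p}. col_inner n X i j = (if i = j then 1 else 0)}"
    by (auto simp: stiefel_iff space_mat_space)
  also have "\<dots> \<in> sets (mat_space n p)"
    by measurable
  finally show ?thesis .
qed

text \<open>An open ball for the Frobenius norm. The bound p + 1 on the squared norm puts the unit
  matrix, of squared norm p when p \<le> n, strictly inside.\<close>

definition mat_ball :: "nat \<Rightarrow> nat \<Rightarrow> (nat \<times> nat \<Rightarrow> real) set" where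
  "mat_ball n p = {X \<in> extensional ({..<n} \<times> {..<p}). (\<Sum>j<p. col_inner n X j j) < real p + 1}"

lemma sets_mat_ball [measurable]: "mat_ball n p \<in> sets (mat_space n p)"
proof -
  have "mat_ball n p = {X \<in> space (mat_space n p). (\<Sum>j<p. col_inner n X j j) < real p + 1}"
    by (simp add: mat_ball_def space_mat_space)
  also have "\<dots> \<in> sets (mat_space n p)" by measurable
  finally show ?thesis .
qed

lemma mat_ball_lmult:
  "Q \<in> orth_group n \<Longrightarrow> X \<in> extensional ({..<n} \<times> {..<p}) \<Longrightarrow> mat_lmult n p Q X \<in> mat_ball n p \<longleftrightarrow> X \<in> mat_ball n p"
  by (simp add: mat_ball_def col_inner_lmult)

lemma emeasure_mat_space_PiE:
  assumes "\<And>i. A i \<in> sets borel"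
  shows "emeasure (mat_space n p) (PiE ({..<n} \<times> {..<p}) A) = (\<Prod>i\<in>{..<n} \<times> {..<p}. emeasure lborel (A i))"
  unfolding mat_space_def using assms by (intro lborel_product.emeasure_PiM) auto

lemma emeasure_mat_ball_finite: "emeasure (mat_space n p) (mat_ball n p) \<noteq> \<infinity>"
proof -
  define r where "r = real p + 1"
  have "X (i, j) \<in> {-r..r}" if X: "X \<in> mat_ball n p" and ij: "i < n" "j < p" for X i j
  proof -
    have "X (i, j) * X (i, j) \<le> col_inner n X j j"
      unfolding col_inner_def using ij by (intro member_le_sum) auto
    also have "\<dots> \<le> (\<Sum>j<p. col_inner n X j j)"
      using ij by (intro member_le_sum) (auto simp: col_inner_def intro!: sum_nonneg)
    also have "\<dots> < r" using X by (simp add: mat_ball_def r_def)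
    \<comment> \<open>Since r \<ge> 1, the bound r on the square of an entry gives the bound r on
      the entry, so the ball lies in a cube.\<close>
    also have "r \<le> r * r" by (simp add: r_def)
    finally have "\<bar>X (i, j)\<bar> \<le> \<bar>r\<bar>"
      using abs_le_square_iff[of "X (i, j)" r] by (simp add: power2_eq_square)
    then show ?thesis by (auto simp: r_def abs_le_iff)
  qed
  then have "mat_ball n p \<subseteq> PiE ({..<n} \<times> {..<p}) (\<lambda>_. {-r..r})"
    by (force simp: mat_ball_def intro!: PiE_I simp del: atLeastAtMost_iff dest: extensional_arb)
  then have "emeasure (mat_space n p) (mat_ball n p) \<le>
      emeasure (mat_space n p) (PiE ({..<n} \<times> {..<p}) (\<lambda>_. {-r..r}))"
    by (rule emeasure_mono) (auto simp: mat_space_def intro!: sets_PiM_I_finite)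
  also have "\<dots> = (\<Prod>i\<in>{..<n} \<times> {..<p}. emeasure lborel {-r..r})"
    by (rule emeasure_mat_space_PiE) auto
  also have "\<dots> < \<infinity>"
    by (auto simp: less_top[symmetric] power_eq_top_ennreal emeasure_lborel_Icc_eq split: if_splits)
  finally show ?thesis by simp
qed

text \<open>A property that holds eventually along every entrywise limit to the unit matrix holds on a
  box around it: otherwise the boxes of radius \<open>1 / (k + 1)\<close> would supply a sequence of
  counterexamples.\<close>

lemma emeasure_pos_near_unit:
  assumes A: "A \<in> sets (mat_space n p)"
    and near: "\<And>Y. (\<And>k. Y k \<in> extensional ({..<n} \<times> {..<p})) \<Longrightarrow>
      (\<And>i j. i < n \<Longrightarrow> j < p \<Longrightarrow> (\<lambda>k. Y k (i, j)) \<longlonglongrightarrow> mat_unit n p (i, j)) \<Longrightarrow>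
      eventually (\<lambda>k. Y k \<in> A) sequentially"
  shows "emeasure (mat_space n p) A \<noteq> 0"
proof -
  define box where "box k = PiE ({..<n} \<times> {..<p})
    (\<lambda>ij. {mat_unit n p ij - 1 / Suc k<..<mat_unit n p ij + 1 / Suc k})" for k :: nat
  have "\<exists>k. box k \<subseteq> A"
  proof (rule ccontr)
    assume "\<not> (\<exists>k. box k \<subseteq> A)"
    then have "\<forall>k. \<exists>X. X \<in> box k \<and> X \<notin> A" by blast
    then obtain Y where Y: "\<And>k. Y k \<in> box k" "\<And>k. Y k \<notin> A" by metis
    have "(\<lambda>k. Y k (i, j)) \<longlonglongrightarrow> mat_unit n p (i, j)" if "i < n" "j < p" for i j
    proof (rule LIM_zero_cancel, rule Lim_null_comparison)
      show "eventually (\<lambda>k. norm (Y k (i, j) - mat_unit n p (i, j)) \<le> 1 / Suc k) sequentially"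
      proof (intro always_eventually allI)
        fix k
        have "(i, j) \<in> {..<n} \<times> {..<p}" using that by simp
        with Y(1)[of k] have "Y k (i, j) \<in> {mat_unit n p (i, j) - 1 / Suc k<..<mat_unit n p (i, j) + 1 / Suc k}"
          unfolding box_def by (rule PiE_mem)
        then show "norm (Y k (i, j) - mat_unit n p (i, j)) \<le> 1 / Suc k"
          by (auto simp: abs_le_iff)
      qed
      show "(\<lambda>k. 1 / real (Suc k)) \<longlonglongrightarrow> 0"
        using LIMSEQ_inverse_real_of_nat by (simp add: inverse_eq_divide)
    qed
    then have "eventually (\<lambda>k. Y k \<in> A) sequentially"
      using Y(1) by (intro near) (auto simp: box_def PiE_def)
    with Y(2) show False by simp
  qed
  then obtain k where k: "box k \<subseteq> A" by blast
  have "emeasure (mat_space n p) (box k) \<noteq> 0"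
    unfolding box_def by (subst emeasure_mat_space_PiE) auto
  moreover have "emeasure (mat_space n p) (box k) \<le> emeasure (mat_space n p) A"
    using k A by (rule emeasure_mono)
  ultimately show ?thesis by auto
qed

lemma mat_lmult_add:
  "mat_lmult n p Q (\<lambda>i\<in>{..<n} \<times> {..<p}. X i + Y i) =
    (\<lambda>i\<in>{..<n} \<times> {..<p}. mat_lmult n p Q X i + mat_lmult n p Q Y i)"
  by (rule mat_eqI[of _ n p])
    (auto simp: mat_lmult_apply sum.distrib[symmetric] distrib_left)

lemma eventually_mat_ball:
  assumes ext: "\<And>k. Y k \<in> extensional ({..<n} \<times> {..<p})"
    and lim: "\<And>i j. i < n \<Longrightarrow> j < p \<Longrightarrow> ((\<lambda>k. Y k (i, j)) \<longlongrightarrow> mat_unit n p (i, j)) F"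
    and "p \<le> n"
  shows "eventually (\<lambda>k. Y k \<in> mat_ball n p) F"
proof -
  have "((\<lambda>k. \<Sum>j<p. col_inner n (Y k) j j) \<longlongrightarrow> (\<Sum>j<p. col_inner n (mat_unit n p) j j)) F"
    unfolding col_inner_def using lim by (intro tendsto_intros) auto
  moreover have "(\<Sum>j<p. col_inner n (mat_unit n p) j j) < real p + 1"
    using mat_unit_stiefel[OF \<open>p \<le> n\<close>] by (simp add: stiefel_iff)
  ultimately have "eventually (\<lambda>k. (\<Sum>j<p. col_inner n (Y k) j j) < real p + 1) F"
    by (rule order_tendstoD)
  then show ?thesis
    using ext by (simp add: mat_ball_def)
qed

text \<open>Left multiplication is additive, is inverted by the transpose and preserves the ball,
  which has positive finite volume. The ball is thus the test set that fixes the scaling factor, and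
  no determinant is computed.\<close>

lemma distr_mat_space_lmult:
  assumes Q: "Q \<in> orth_group n" and "p \<le> n"
  shows "distr (mat_space n p) (mat_space n p) (mat_lmult n p Q) = mat_space n p"
proof -
  have pos: "emeasure (mat_space n p) (mat_ball n p) \<noteq> 0"
    using \<open>p \<le> n\<close> by (intro emeasure_pos_near_unit eventually_mat_ball) auto
  have ball_minus: "(\<lambda>i\<in>{..<n} \<times> {..<p}. - X i) \<in> mat_ball n p \<longleftrightarrow> X \<in> mat_ball n p"
    if "X \<in> extensional ({..<n} \<times> {..<p})" for X :: "nat \<times> nat \<Rightarrow> real"
    using that by (simp add: mat_ball_def col_inner_def)
  show ?thesis
    using distr_PiM_lborel_additive[where I = "{..<n} \<times> {..<p}" and T = "mat_lmult n p Q"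
        and T' = "mat_lmult n p (mat_transpose n Q)" and B = "mat_ball n p", folded mat_space_def,
        OF _ measurable_mat_lmult mat_lmult_extensional mat_lmult_add orth_group_transpose_cancel[OF Q]
          sets_mat_ball mat_ball_lmult[OF Q] ball_minus pos emeasure_mat_ball_finite]
    by simp
qed

section \<open>Gram-Schmidt orthogonalisation\<close>

text \<open>Column j minus its projections onto the earlier columns; these are the true projections
  only when the earlier columns are already orthonormal.\<close>

definition gs_residual :: "nat \<Rightarrow> nat \<Rightarrow> (nat \<times> nat \<Rightarrow> real) \<Rightarrow> nat \<Rightarrow> real" where
  "gs_residual n j X i = X (i, j) - (\<Sum>l<j. col_inner n X j l * X (i, l))"

text \<open>The squared length of the residual; the root is taken in \<open>gs_step\<close>.\<close>

definition gs_norm :: "nat \<Rightarrow> nat \<Rightarrow> (nat \<times> nat \<Rightarrow> real) \<Rightarrow> real" where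
  "gs_norm n j X = (\<Sum>k<n. gs_residual n j X k * gs_residual n j X k)"

definition gs_step :: "nat \<Rightarrow> nat \<Rightarrow> (nat \<times> nat \<Rightarrow> real) \<Rightarrow> nat \<times> nat \<Rightarrow> real" where
  "gs_step n j X = restrict (\<lambda>(i, l). if l = j then gs_residual n j X i / sqrt (gs_norm n j X)
     else X (i, l)) ({..<n} \<times> {..<n})"

text \<open>The number counts the columns already processed. A vanishing residual yields a zero
  column through x / 0 = 0, so the map is total; such degenerate matrices are discarded
  later.\<close>

fun gram_schmidt :: "nat \<Rightarrow> nat \<Rightarrow> (nat \<times> nat \<Rightarrow> real) \<Rightarrow> nat \<times> nat \<Rightarrow> real" where
  "gram_schmidt n 0 X = X"
| "gram_schmidt n (Suc j) X = gs_step n j (gram_schmidt n j X)"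

lemma gs_step_apply:
  "i < n \<Longrightarrow> l < n \<Longrightarrow>
    gs_step n j X (i, l) = (if l = j then gs_residual n j X i / sqrt (gs_norm n j X) else X (i, l))"
  by (simp add: gs_step_def)

lemma gs_step_extensional [simp]: "gs_step n j X \<in> extensional ({..<n} \<times> {..<n})"
  by (simp add: gs_step_def)

lemma gram_schmidt_extensional:
  "X \<in> extensional ({..<n} \<times> {..<n}) \<Longrightarrow> gram_schmidt n j X \<in> extensional ({..<n} \<times> {..<n})"
  by (cases j) auto

lemma measurable_gs_residual [measurable]:
  "i < n \<Longrightarrow> j < n \<Longrightarrow> (\<lambda>X. gs_residual n j X i) \<in> borel_measurable (mat_space n n)"
  unfolding gs_residual_def by measurable

lemma measurable_gs_norm [measurable]:
  "j < n \<Longrightarrow> gs_norm n j \<in> borel_measurable (mat_space n n)"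
  unfolding gs_norm_def by measurable

lemma measurable_gs_step [measurable]:
  "j < n \<Longrightarrow> gs_step n j \<in> measurable (mat_space n n) (mat_space n n)"
  by (rule measurable_into_mat_space) (auto simp: gs_step_apply)

lemma measurable_gram_schmidt [measurable]:
  "j \<le> n \<Longrightarrow> gram_schmidt n j \<in> measurable (mat_space n n) (mat_space n n)"
proof (induction j)
  case 0
  then show ?case by (simp add: measurable_ident_sets[OF refl])
next
  case (Suc j)
  then have "(\<lambda>X. gs_step n j (gram_schmidt n j X)) \<in> measurable (mat_space n n) (mat_space n n)"
    by (intro measurable_compose[OF _ measurable_gs_step]) auto
  then show ?case by simp
qed

text \<open>The coefficients are inner products of columns, which \<open>Q\<close> preserves. With
  these fixed, the residual is a linear combination of columns and \<open>Q\<close> passes through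
  it.\<close>

lemma gs_residual_lmult:
  assumes Q: "Q \<in> orth_group n" and "i < n" "j < n"
  shows "gs_residual n j (mat_lmult n n Q X) i = (\<Sum>m<n. Q (i, m) * gs_residual n j X m)"
proof -
  have "gs_residual n j (mat_lmult n n Q X) i =
      (\<Sum>m<n. Q (i, m) * X (m, j)) - (\<Sum>l<j. \<Sum>m<n. col_inner n X j l * (Q (i, m) * X (m, l)))"
    using assms by (simp add: gs_residual_def mat_lmult_apply col_inner_lmult sum_distrib_left)
  also have "(\<Sum>l<j. \<Sum>m<n. col_inner n X j l * (Q (i, m) * X (m, l))) =
      (\<Sum>m<n. \<Sum>l<j. col_inner n X j l * (Q (i, m) * X (m, l)))"
    by (rule sum.swap)
  also have "(\<Sum>m<n. Q (i, m) * X (m, j)) - \<dots> = (\<Sum>m<n. Q (i, m) * gs_residual n j X m)"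
    by (simp add: gs_residual_def right_diff_distrib sum_subtractf sum_distrib_left mult_ac)
  finally show ?thesis .
qed

lemma gs_norm_lmult:
  assumes Q: "Q \<in> orth_group n" and "j < n"
  shows "gs_norm n j (mat_lmult n n Q X) = gs_norm n j X"
proof -
  \<comment> \<open>The residual is viewed as a matrix with a single column, so that
    \<open>col_inner_lmult\<close> also covers its length.\<close>
  define R where "R = (\<lambda>(i, l :: nat). gs_residual n j X i)"
  have "gs_norm n j (mat_lmult n n Q X) = col_inner n (mat_lmult n 1 Q R) 0 0"
    using assms by (simp add: gs_norm_def gs_residual_lmult col_inner_def mat_lmult_apply R_def)
  also have "\<dots> = col_inner n R 0 0"
    using Q by (rule col_inner_lmult) auto
  finally show ?thesis by (simp add: col_inner_def R_def gs_norm_def)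
qed

lemma gs_step_lmult:
  assumes "Q \<in> orth_group n" and "j < n"
  shows "gs_step n j (mat_lmult n n Q X) = mat_lmult n n Q (gs_step n j X)"
  by (rule mat_eqI[of _ n n])
    (use assms in \<open>auto simp: gs_step_apply mat_lmult_apply gs_residual_lmult gs_norm_lmult sum_divide_distrib\<close>)

lemma gram_schmidt_lmult:
  assumes "Q \<in> orth_group n" and "j \<le> n"
  shows "gram_schmidt n j (mat_lmult n n Q X) = mat_lmult n n Q (gram_schmidt n j X)"
  using \<open>j \<le> n\<close> by (induction j) (use assms(1) in \<open>auto simp: gs_step_lmult\<close>)

text \<open>Orthonormality of the old columns makes the subtracted projections cancel every inner
  product with them, dividing by the positive length normalises the new column, and the old columns
  stay unchanged.\<close>

lemma gs_step_orthonormal: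
  assumes "j < n" and norm: "gs_norm n j X > 0"
    and orth: "\<And>a b. a < j \<Longrightarrow> b < j \<Longrightarrow> col_inner n X a b = (if a = b then 1 else 0)"
    and ab: "a < Suc j" "b < Suc j"
  shows "col_inner n (gs_step n j X) a b = (if a = b then 1 else 0)"
proof -
  have perp: "col_inner n (gs_step n j X) j b = 0" if "b < j" for b
  proof -
    have "(\<Sum>k<n. gs_residual n j X k * X (k, b)) =
        col_inner n X j b - (\<Sum>k<n. \<Sum>l<j. col_inner n X j l * (X (k, l) * X (k, b)))"
      by (simp add: gs_residual_def col_inner_def[of n X _ b] left_diff_distrib sum_subtractf
          sum_distrib_right mult.assoc)
    also have "(\<Sum>k<n. \<Sum>l<j. col_inner n X j l * (X (k, l) * X (k, b))) =
        (\<Sum>l<j. \<Sum>k<n. col_inner n X j l * (X (k, l) * X (k, b)))"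
      by (rule sum.swap)
    also have "\<dots> = (\<Sum>l<j. col_inner n X j l * col_inner n X l b)"
      by (simp add: col_inner_def[of n X _ b] sum_distrib_left)
    also have "\<dots> = (\<Sum>l<j. if l = b then col_inner n X j l else 0)"
      using that by (intro sum.cong) (auto simp: orth)
    also have "\<dots> = col_inner n X j b" using that by simp
    finally have *: "(\<Sum>k<n. gs_residual n j X k * X (k, b)) = 0" by simp
    have "col_inner n (gs_step n j X) j b =
        (\<Sum>k<n. gs_residual n j X k * X (k, b)) / sqrt (gs_norm n j X)"
      using that \<open>j < n\<close> by (simp add: col_inner_def gs_step_apply sum_divide_distrib)
    with * show ?thesis by simp
  qed
  have perp': "col_inner n (gs_step n j X) b j = 0" if "b < j" for b
    using perp[OF that] by (simp add: col_inner_def mult.commute)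
  have unit: "col_inner n (gs_step n j X) j j = 1"
  proof -
    have "col_inner n (gs_step n j X) j j =
        (\<Sum>k<n. gs_residual n j X k * gs_residual n j X k / gs_norm n j X)"
      using norm \<open>j < n\<close> by (simp add: col_inner_def gs_step_apply)
    also have "\<dots> = 1"
      using norm by (simp add: sum_divide_distrib[symmetric] gs_norm_def)
    finally show ?thesis .
  qed
  have old: "col_inner n (gs_step n j X) a b = col_inner n X a b" if "a < j" "b < j" for a b
    using that \<open>j < n\<close> by (simp add: col_inner_def gs_step_apply)
  consider "a = j" "b = j" | "a = j" "b < j" | "a < j" "b = j" | "a < j" "b < j"
    using ab by linarith
  then show ?thesis
    by cases (use perp perp' unit old orth in auto)
qed

section \<open>Continuity of the orthogonalisation at the unit matrix\<close>

lemma gs_residual_tendsto: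
  assumes lim: "\<And>i l. i < n \<Longrightarrow> l < n \<Longrightarrow> ((\<lambda>k. Y k (i, l)) \<longlongrightarrow> mat_unit n n (i, l)) F"
    and ij: "i < n" "j < n"
  shows "((\<lambda>k. gs_residual n j (Y k) i) \<longlongrightarrow> mat_unit n n (i, j)) F"
proof -
  have "((\<lambda>k. gs_residual n j (Y k) i) \<longlongrightarrow>
      mat_unit n n (i, j) - (\<Sum>l<j. col_inner n (mat_unit n n) j l * mat_unit n n (i, l))) F"
    unfolding gs_residual_def col_inner_def using ij by (intro tendsto_intros lim) auto
  also have "(\<Sum>l<j. col_inner n (mat_unit n n) j l * mat_unit n n (i, l)) = 0"
    using mat_unit_stiefel[of n n] ij by (intro sum.neutral) (auto simp: stiefel_iff)
  finally show ?thesis by simp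
qed

lemma gs_norm_tendsto:
  assumes lim: "\<And>i l. i < n \<Longrightarrow> l < n \<Longrightarrow> ((\<lambda>k. Y k (i, l)) \<longlongrightarrow> mat_unit n n (i, l)) F"
    and "j < n"
  shows "((\<lambda>k. gs_norm n j (Y k)) \<longlongrightarrow> 1) F"
proof -
  have "((\<lambda>k. gs_norm n j (Y k)) \<longlongrightarrow> col_inner n (mat_unit n n) j j) F"
    unfolding gs_norm_def col_inner_def using \<open>j < n\<close>
    by (intro tendsto_intros gs_residual_tendsto lim) auto
  then show ?thesis
    using mat_unit_stiefel[of n n] \<open>j < n\<close> by (simp add: stiefel_iff)
qed

lemma gram_schmidt_tendsto:
  assumes lim: "\<And>i l. i < n \<Longrightarrow> l < n \<Longrightarrow> ((\<lambda>k. Y k (i, l)) \<longlongrightarrow> mat_unit n n (i, l)) F"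
    and "j \<le> n" "i < n" "l < n"
  shows "((\<lambda>k. gram_schmidt n j (Y k) (i, l)) \<longlongrightarrow> mat_unit n n (i, l)) F"
  using \<open>j \<le> n\<close> \<open>i < n\<close> \<open>l < n\<close>
proof (induction j arbitrary: i l)
  case 0
  then show ?case using lim by simp
next
  case (Suc j)
  have IH: "((\<lambda>k. gram_schmidt n j (Y k) (i, l)) \<longlongrightarrow> mat_unit n n (i, l)) F" if "i < n" "l < n" for i l
    using Suc that by simp
  show ?case
  proof (cases "l = j")
    case True
    have "((\<lambda>k. gs_residual n j (gram_schmidt n j (Y k)) i / sqrt (gs_norm n j (gram_schmidt n j (Y k))))
        \<longlongrightarrow> mat_unit n n (i, j) / sqrt 1) F"
      using Suc.prems by (intro tendsto_intros gs_residual_tendsto gs_norm_tendsto IH) auto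
    then show ?thesis using True Suc.prems by (simp add: gs_step_apply)
  next
    case False
    then show ?thesis using IH Suc.prems by (simp add: gs_step_apply)
  qed
qed

text \<open>Each squared residual length tends to 1, its value at the unit matrix, so it is
  eventually positive and no step degenerates.\<close>

lemma gram_schmidt_eventually_orthonormal:
  assumes lim: "\<And>i l. i < n \<Longrightarrow> l < n \<Longrightarrow> ((\<lambda>k. Y k (i, l)) \<longlongrightarrow> mat_unit n n (i, l)) F"
    and "j \<le> n"
  shows "eventually (\<lambda>k. \<forall>a<j. \<forall>b<j. col_inner n (gram_schmidt n j (Y k)) a b = (if a = b then 1 else 0)) F"
  using \<open>j \<le> n\<close>
proof (induction j)
  case (Suc j)
  have "((\<lambda>k. gs_norm n j (gram_schmidt n j (Y k))) \<longlongrightarrow> 1) F"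
    using Suc.prems by (intro gs_norm_tendsto gram_schmidt_tendsto lim) auto
  then have "eventually (\<lambda>k. 0 < gs_norm n j (gram_schmidt n j (Y k))) F"
    by (rule order_tendstoD) simp
  moreover have "eventually (\<lambda>k. \<forall>a<j. \<forall>b<j. col_inner n (gram_schmidt n j (Y k)) a b = (if a = b then 1 else 0)) F"
    using Suc by simp
  ultimately show ?case
  proof eventually_elim
    case (elim k)
    show ?case
      using gs_step_orthonormal[of j n "gram_schmidt n j (Y k)"] elim Suc.prems by simp
  qed
qed simp

section \<open>Haar measure on the Stiefel manifold\<close>

text \<open>The predicate under the definite description in \<open>haar_stiefel\<close>, named so
  that existence and uniqueness can be stated.\<close>

definition invariant_prob :: "nat \<Rightarrow> nat \<Rightarrow> (nat \<times> nat \<Rightarrow> real) measure \<Rightarrow> bool" where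
  "invariant_prob n p \<mu> \<longleftrightarrow> sets \<mu> = sets (mat_space n p) \<and> prob_space \<mu> \<and>
     emeasure \<mu> (stiefel n p) = 1 \<and>
     (\<forall>Q\<in>orth_group n. distr \<mu> (mat_space n p) (mat_lmult n p Q) = \<mu>)"

lemma invariant_prob_AE_stiefel:
  assumes "invariant_prob n p \<mu>"
  shows "AE X in \<mu>. X \<in> stiefel n p"
proof -
  interpret prob_space \<mu> using assms by (simp add: invariant_prob_def)
  show ?thesis
    using assms sets_stiefel[of n p]
    by (intro AE_prob_1) (simp add: invariant_prob_def measure_def)
qed

text \<open>Gram-Schmidt orthogonalisation commutes with left multiplication by orthogonal matrices, so
  it carries the uniform distribution on the nondegenerate part of a ball to an invariant
  one.\<close>

lemma invariant_prob_orth_group_exists: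
  obtains \<mu> where "invariant_prob n n \<mu>"
    and "\<And>\<epsilon>. \<epsilon> > 0 \<Longrightarrow> emeasure \<mu> {X \<in> space (mat_space n n). \<forall>j<n. 1 - \<epsilon> < X (j, j)} \<noteq> 0"
proof -
  let ?M = "mat_space n n" and ?G = "gram_schmidt n n"
  have G: "?G \<in> measurable ?M ?M" by (rule measurable_gram_schmidt) simp
  have preG: "{X \<in> space ?M. ?G X \<in> A} \<in> sets ?M" if "A \<in> sets ?M" for A
    using measurable_sets[OF G that] by (simp add: vimage_def Int_def conj_commute)
  \<comment> \<open>The part of the ball on which the orthogonalisation really ends in an orthogonal
    matrix.\<close>
  define W where "W = mat_ball n n \<inter> {X \<in> space ?M. ?G X \<in> stiefel n n}"
  have W: "W \<in> sets ?M" unfolding W_def by (intro sets.Int sets_mat_ball preG sets_stiefel)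
  define N where "N \<epsilon> = {X \<in> space ?M. \<forall>j<n. 1 - \<epsilon> < X (j, j)}" for \<epsilon> :: real
  have N: "N \<epsilon> \<in> sets ?M" for \<epsilon>
  proof -
    have "N \<epsilon> = {X \<in> space ?M. \<forall>j\<in>{..<n}. 1 - \<epsilon> < X (j, j)}" by (auto simp: N_def)
    also have "\<dots> \<in> sets ?M" by measurable
    finally show ?thesis .
  qed
  \<comment> \<open>Near the unit matrix the orthogonalisation succeeds and stays close to the unit
    matrix. The same fact gives \<open>W\<close> positive volume and, after normalisation, the
    positive mass of neighbourhoods of the unit matrix.\<close>
  have near: "emeasure ?M (W \<inter> {X \<in> space ?M. ?G X \<in> N \<epsilon>}) \<noteq> 0" if "\<epsilon> > 0" for \<epsilon>
  proof (rule emeasure_pos_near_unit)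
    show "W \<inter> {X \<in> space ?M. ?G X \<in> N \<epsilon>} \<in> sets ?M" by (intro sets.Int W preG N)
  next
    fix Y :: "nat \<Rightarrow> nat \<times> nat \<Rightarrow> real"
    assume ext: "\<And>k. Y k \<in> extensional ({..<n} \<times> {..<n})"
      and lim: "\<And>i j. i < n \<Longrightarrow> j < n \<Longrightarrow> (\<lambda>k. Y k (i, j)) \<longlonglongrightarrow> mat_unit n n (i, j)"
    have "eventually (\<lambda>k. Y k \<in> mat_ball n n) sequentially"
      using ext lim by (intro eventually_mat_ball) auto
    moreover have "eventually (\<lambda>k. ?G (Y k) \<in> stiefel n n) sequentially"
      using gram_schmidt_eventually_orthonormal[where j = n, OF lim] ext
      by (simp add: stiefel_iff gram_schmidt_extensional)
    moreover have "eventually (\<lambda>k. \<forall>j\<in>{..<n}. 1 - \<epsilon> < ?G (Y k) (j, j)) sequentially"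
    proof (intro eventually_ball_finite ballI)
      fix j assume "j \<in> {..<n}"
      then have "(\<lambda>k. ?G (Y k) (j, j)) \<longlonglongrightarrow> 1"
        using gram_schmidt_tendsto[where j = n and i = j and l = j, OF lim] by (simp add: mat_unit_apply)
      then show "eventually (\<lambda>k. 1 - \<epsilon> < ?G (Y k) (j, j)) sequentially"
        using \<open>\<epsilon> > 0\<close> by (intro order_tendstoD) auto
    qed simp
    ultimately show "eventually (\<lambda>k. Y k \<in> W \<inter> {X \<in> space ?M. ?G X \<in> N \<epsilon>}) sequentially"
      by eventually_elim
        (use ext in \<open>simp add: W_def N_def space_mat_space gram_schmidt_extensional\<close>)
  qed
  have W_pos: "emeasure ?M W \<noteq> 0"
  proof
    assume W0: "emeasure ?M W = 0"
    have "emeasure ?M (W \<inter> {X \<in> space ?M. ?G X \<in> N 1}) \<le> emeasure ?M W"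
      by (intro emeasure_mono W) auto
    with near[of 1] W0 show False by simp
  qed
  have W_fin: "emeasure ?M W \<noteq> \<infinity>"
  proof -
    have "emeasure ?M W \<le> emeasure ?M (mat_ball n n)"
      by (intro emeasure_mono) (auto simp: W_def)
    then show ?thesis using emeasure_mat_ball_finite[of n n] by (auto simp: top_unique)
  qed
  define \<mu> where "\<mu> = distr (uniform_measure ?M W) ?M ?G"
  have sets_\<mu>: "sets \<mu> = sets ?M" by (simp add: \<mu>_def)
  have \<mu>_eq: "emeasure \<mu> A = emeasure ?M (W \<inter> {X \<in> space ?M. ?G X \<in> A}) / emeasure ?M W"
    if "A \<in> sets ?M" for A
  proof -
    have "?G \<in> measurable (uniform_measure ?M W) ?M"
      using G by (simp add: measurable_cong_sets[of "uniform_measure ?M W" ?M])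
    moreover have "?G -` A \<inter> space ?M = {X \<in> space ?M. ?G X \<in> A}" by auto
    ultimately show ?thesis
      using that W preG[OF that] unfolding \<mu>_def by (simp add: emeasure_distr)
  qed
  interpret prob_space \<mu>
    unfolding \<mu>_def using prob_space_uniform_measure[OF W_pos W_fin]
    by (rule prob_space.prob_space_distr)
      (use G in \<open>simp add: measurable_cong_sets[of "uniform_measure ?M W" ?M]\<close>)
  have "invariant_prob n n \<mu>"
    unfolding invariant_prob_def
  proof (intro conjI ballI)
    have "W \<inter> {X \<in> space ?M. ?G X \<in> stiefel n n} = W" by (auto simp: W_def)
    then show "emeasure \<mu> (stiefel n n) = 1"
      using W_pos W_fin by (simp add: \<mu>_eq less_top)
  next
    fix Q assume Q: "Q \<in> orth_group n"
    show "distr \<mu> ?M (mat_lmult n n Q) = \<mu>"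
    proof (rule measure_eqI)
      fix A assume "A \<in> sets (distr \<mu> ?M (mat_lmult n n Q))"
      then have A: "A \<in> sets ?M" by simp
      have QA: "mat_lmult n n Q -` A \<inter> space ?M \<in> sets ?M"
        by (rule measurable_sets[OF measurable_mat_lmult A])
      have GA: "W \<inter> {X \<in> space ?M. ?G X \<in> A} \<in> sets ?M" by (intro sets.Int W preG A)
      \<comment> \<open>Both \<open>W\<close> and the orthogonalisation are compatible with
        \<open>Q\<close>, so invariance of the push-forward reduces to invariance of Lebesgue
        measure.\<close>
      have "W \<inter> {X \<in> space ?M. ?G X \<in> mat_lmult n n Q -` A \<inter> space ?M} =
          mat_lmult n n Q -` (W \<inter> {X \<in> space ?M. ?G X \<in> A}) \<inter> space ?M"
      proof -
        have "?G X \<in> stiefel n n \<longleftrightarrow> mat_lmult n n Q (?G X) \<in> stiefel n n"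
          if "X \<in> extensional ({..<n} \<times> {..<n})" for X
          using gram_schmidt_extensional[OF that, of n] Q by (simp add: stiefel_iff col_inner_lmult)
        then show ?thesis
          using Q by (auto simp: W_def space_mat_space mat_ball_lmult gram_schmidt_lmult gram_schmidt_extensional)
      qed
      then have "emeasure ?M (W \<inter> {X \<in> space ?M. ?G X \<in> mat_lmult n n Q -` A \<inter> space ?M}) =
          emeasure (distr ?M ?M (mat_lmult n n Q)) (W \<inter> {X \<in> space ?M. ?G X \<in> A})"
        using GA by (simp add: emeasure_distr)
      then have "emeasure \<mu> (mat_lmult n n Q -` A \<inter> space ?M) = emeasure \<mu> A"
        using QA A Q by (simp add: \<mu>_eq distr_mat_space_lmult)
      moreover have "mat_lmult n n Q \<in> measurable \<mu> ?M"
        using measurable_mat_lmult by (simp only: measurable_cong_sets[OF sets_\<mu> refl])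
      ultimately show "emeasure (distr \<mu> ?M (mat_lmult n n Q)) A = emeasure \<mu> A"
        using A by (simp add: emeasure_distr sets_eq_imp_space_eq[OF sets_\<mu>])
    qed (simp add: sets_\<mu>)
  qed (use sets_\<mu> prob_space_axioms in auto)
  moreover have "emeasure \<mu> {X \<in> space ?M. \<forall>j<n. 1 - \<epsilon> < X (j, j)} \<noteq> 0" if "\<epsilon> > 0" for \<epsilon>
  using near[OF that] W_fin N[of \<epsilon>] by (simp add: \<mu>_eq ennreal_divide_eq_0_iff flip: N_def)
  ultimately show thesis by (rule that)
qed

text \<open>The law of \<open>g\<^sup>T\<close>, for \<open>g\<close> distributed according to \<open>\<kappa>\<close>, is right invariant. Averaging
  \<open>g\<^sup>T X\<close> over \<open>g\<close> and \<open>X\<close> therefore gives \<open>\<mu>\<close> when integrated over \<open>X\<close> first, and a law not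
  depending on \<open>\<mu>\<close> when integrated over \<open>g\<close> first.\<close>

lemma invariant_prob_unique:
  assumes \<kappa>: "invariant_prob n n \<kappa>" and \<mu>: "invariant_prob n p \<mu>" and "p \<le> n"
  shows "\<mu> = distr \<kappa> (mat_space n p) (\<lambda>g. mat_lmult n p (mat_transpose n g) (mat_unit n p))"
    (is "_ = distr _ _ ?f")
proof (rule measure_eqI)
  interpret L: prob_space \<kappa> using \<kappa> by (simp add: invariant_prob_def)
  interpret M: prob_space \<mu> using \<mu> by (simp add: invariant_prob_def)
  interpret pair_sigma_finite \<mu> \<kappa> ..
  have [measurable_cong]: "sets \<kappa> = sets (mat_space n n)" "sets \<mu> = sets (mat_space n p)"
    using \<kappa> \<mu> by (auto simp: invariant_prob_def)
  have pair [measurable]: "(\<lambda>(X, g). mat_lmult n p (mat_transpose n g) X) \<in>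
      measurable (mat_space n p \<Otimes>\<^sub>M mat_space n n) (mat_space n p)"
    by (rule measurable_into_mat_space) (auto simp: mat_lmult_apply mat_transpose_apply split_beta)
  have f [measurable]: "?f \<in> measurable (mat_space n n) (mat_space n p)"
    by (rule measurable_into_mat_space) (auto simp: mat_lmult_apply mat_transpose_apply)
  show "sets \<mu> = sets (distr \<kappa> (mat_space n p) ?f)"
    using \<mu> by (simp add: invariant_prob_def)
  fix A assume "A \<in> sets \<mu>"
  then have A [measurable]: "A \<in> sets (mat_space n p)" using \<mu> by (simp add: invariant_prob_def)
  have "emeasure \<mu> A = (\<integral>\<^sup>+g. emeasure \<mu> A \<partial>\<kappa>)"
    by (simp add: L.emeasure_space_1)
  also have "\<dots> = (\<integral>\<^sup>+g. \<integral>\<^sup>+X. indicator A (mat_lmult n p (mat_transpose n g) X) \<partial>\<mu> \<partial>\<kappa>)"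
  proof (rule nn_integral_cong_AE)
    show "AE g in \<kappa>. emeasure \<mu> A = (\<integral>\<^sup>+X. indicator A (mat_lmult n p (mat_transpose n g) X) \<partial>\<mu>)"
      using invariant_prob_AE_stiefel[OF \<kappa>]
    proof eventually_elim
      case (elim g)
      then have "mat_transpose n g \<in> orth_group n"
        by (simp add: orth_group_def[symmetric] orth_group_transpose)
      then have "\<mu> = distr \<mu> (mat_space n p) (mat_lmult n p (mat_transpose n g))"
        using \<mu> by (simp add: invariant_prob_def)
      then have "emeasure \<mu> A = (\<integral>\<^sup>+X. indicator A X \<partial>distr \<mu> (mat_space n p) (mat_lmult n p (mat_transpose n g)))"
        by simp
      also have "\<dots> = (\<integral>\<^sup>+X. indicator A (mat_lmult n p (mat_transpose n g) X) \<partial>\<mu>)"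
        by (rule nn_integral_distr) measurable
      finally show ?case .
    qed
  qed
  also have "\<dots> = (\<integral>\<^sup>+X. \<integral>\<^sup>+g. indicator A (mat_lmult n p (mat_transpose n g) X) \<partial>\<kappa> \<partial>\<mu>)"
    by (rule Fubini') measurable
  also have "\<dots> = (\<integral>\<^sup>+X. emeasure (distr \<kappa> (mat_space n p) ?f) A \<partial>\<mu>)"
  proof (rule nn_integral_cong_AE)
    show "AE X in \<mu>. (\<integral>\<^sup>+g. indicator A (mat_lmult n p (mat_transpose n g) X) \<partial>\<kappa>) =
        emeasure (distr \<kappa> (mat_space n p) ?f) A"
      using invariant_prob_AE_stiefel[OF \<mu>]
    proof eventually_elim
      case (elim X)
      then obtain H where H: "H \<in> orth_group n" "mat_transpose n H \<in> orth_group n"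
        and X: "X = mat_lmult n p H (mat_unit n p)"
        using stiefel_transitive[OF _ \<open>p \<le> n\<close>] by blast
      have "mat_transpose n (mat_transpose n H) = H"
        using H(1) by (simp add: orth_group_iff mat_transpose_transpose)
      \<comment> \<open>With X = H E, where E is the unit matrix, g^T X = (H^T g)^T E. Left
        invariance of \<open>\<kappa>\<close> under H^T then removes the dependence on X.\<close>
      then have fX: "mat_lmult n p (mat_transpose n g) X = ?f (mat_lmult n n (mat_transpose n H) g)" for g
        by (simp add: X mat_lmult_assoc mat_transpose_mult)
      have "(\<integral>\<^sup>+g. indicator A (mat_lmult n p (mat_transpose n g) X) \<partial>\<kappa>) =
          (\<integral>\<^sup>+g. indicator A (?f g) \<partial>distr \<kappa> (mat_space n n) (mat_lmult n n (mat_transpose n H)))"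
        unfolding fX by (rule nn_integral_distr[symmetric]) measurable
      also have "distr \<kappa> (mat_space n n) (mat_lmult n n (mat_transpose n H)) = \<kappa>"
        using \<kappa> H(2) by (simp add: invariant_prob_def)
      also have "(\<integral>\<^sup>+g. indicator A (?f g) \<partial>\<kappa>) = (\<integral>\<^sup>+Y. indicator A Y \<partial>distr \<kappa> (mat_space n p) ?f)"
        by (rule nn_integral_distr[symmetric]) measurable
      finally show ?case by simp
    qed
  qed
  also have "\<dots> = emeasure (distr \<kappa> (mat_space n p) ?f) A"
    by (simp add: M.emeasure_space_1)
  finally show "emeasure \<mu> A = emeasure (distr \<kappa> (mat_space n p) ?f) A" .
qed

text \<open>Multiplying by the rectangular unit matrix keeps the first p columns, and this commutes
  with left multiplication. Existence in the square case therefore carries over to every p \<le>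
  n.\<close>

lemma invariant_prob_distr_unit:
  assumes \<kappa>: "invariant_prob n n \<kappa>" and "p \<le> n"
  shows "invariant_prob n p (distr \<kappa> (mat_space n p) (\<lambda>g. mat_lmult n p g (mat_unit n p)))"
    (is "invariant_prob n p (distr \<kappa> _ ?f)")
proof -
  interpret L: prob_space \<kappa> using \<kappa> by (simp add: invariant_prob_def)
  have [measurable_cong]: "sets \<kappa> = sets (mat_space n n)"
    using \<kappa> by (auto simp: invariant_prob_def)
  have f [measurable]: "?f \<in> measurable \<kappa> (mat_space n p)"
    by (rule measurable_into_mat_space) (auto simp: mat_lmult_apply)
  interpret M: prob_space "distr \<kappa> (mat_space n p) ?f"
    by (rule L.prob_space_distr) measurable
  have f_stiefel: "?f g \<in> stiefel n p" if "g \<in> stiefel n n" for g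
    using that mat_unit_stiefel[OF \<open>p \<le> n\<close>] by (simp add: stiefel_lmult orth_group_def)
  show ?thesis
    unfolding invariant_prob_def
  proof (intro conjI ballI)
    have "AE X in distr \<kappa> (mat_space n p) ?f. X \<in> stiefel n p"
      using invariant_prob_AE_stiefel[OF \<kappa>] f_stiefel
      by (subst AE_distr_iff) (auto elim: eventually_mono)
    then show "emeasure (distr \<kappa> (mat_space n p) ?f) (stiefel n p) = 1"
      using M.emeasure_eq_1_AE by auto
  next
    fix Q assume Q: "Q \<in> orth_group n"
    have "distr (distr \<kappa> (mat_space n p) ?f) (mat_space n p) (mat_lmult n p Q) =
        distr \<kappa> (mat_space n p) (mat_lmult n p Q \<circ> ?f)"
      by (rule distr_distr) measurable
    also have "mat_lmult n p Q \<circ> ?f = ?f \<circ> mat_lmult n n Q"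
      by (simp add: fun_eq_iff mat_lmult_assoc)
    also have "distr \<kappa> (mat_space n p) \<dots> = distr (distr \<kappa> (mat_space n n) (mat_lmult n n Q)) (mat_space n p) ?f"
      by (rule distr_distr[symmetric]) measurable
    also have "distr \<kappa> (mat_space n n) (mat_lmult n n Q) = \<kappa>"
      using \<kappa> Q by (simp add: invariant_prob_def)
    finally show "distr (distr \<kappa> (mat_space n p) ?f) (mat_space n p) (mat_lmult n p Q) =
        distr \<kappa> (mat_space n p) ?f" .
  qed (use M.prob_space_axioms in auto)
qed

text \<open>By \<open>invariant_prob_unique\<close> every invariant probability equals one and the
  same image of \<open>\<kappa>\<close>, so the description denotes \<open>\<mu>\<close>.\<close>

lemma haar_stiefel_eq:
  assumes "invariant_prob n p \<mu>" and "p \<le> n"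
  shows "haar_stiefel n p = \<mu>"
proof -
  obtain \<kappa> where \<kappa>: "invariant_prob n n \<kappa>"
    using invariant_prob_orth_group_exists by blast
  have "haar_stiefel n p = (THE \<mu>. invariant_prob n p \<mu>)"
    by (simp add: haar_stiefel_def invariant_prob_def)
  also have "\<dots> = \<mu>"
    using assms invariant_prob_unique[OF \<kappa> _ \<open>p \<le> n\<close>] by (intro the_equality) auto
  finally show ?thesis .
qed

lemma haar_stiefel_invariant:
  assumes "p \<le> n" shows "invariant_prob n p (haar_stiefel n p)"
proof -
  obtain \<kappa> where \<kappa>: "invariant_prob n n \<kappa>"
    using invariant_prob_orth_group_exists by blast
  show ?thesis
    using invariant_prob_distr_unit[OF \<kappa> assms]
      haar_stiefel_eq[OF invariant_prob_distr_unit[OF \<kappa> assms] assms] by simp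
qed

text \<open>The Haar measure is the law of the first p columns of a random orthogonal matrix.
  Passing to these columns keeps the first p diagonal entries, so the square case suffices.\<close>

lemma haar_stiefel_near_unit:
  assumes "p \<le> n" "\<epsilon> > 0"
  shows "emeasure (haar_stiefel n p) {X \<in> space (mat_space n p). \<forall>j<p. 1 - \<epsilon> < X (j, j)} \<noteq> 0"
proof -
  obtain \<kappa> where \<kappa>: "invariant_prob n n \<kappa>"
    and near: "\<And>\<epsilon>. \<epsilon> > 0 \<Longrightarrow> emeasure \<kappa> {X \<in> space (mat_space n n). \<forall>j<n. 1 - \<epsilon> < X (j, j)} \<noteq> 0"
    by (rule invariant_prob_orth_group_exists[of n]) (rule that; blast)
  have sets_eq [measurable_cong]: "sets \<kappa> = sets (mat_space n n)"
    using \<kappa> by (simp add: invariant_prob_def)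
  note sp = sets_eq_imp_space_eq[OF sets_eq]
  let ?f = "\<lambda>g. mat_lmult n p g (mat_unit n p)"
  let ?N = "{X \<in> space (mat_space n p). \<forall>j<p. 1 - \<epsilon> < X (j, j)}"
  have f: "?f \<in> measurable \<kappa> (mat_space n p)"
    by (rule measurable_into_mat_space) (auto simp: mat_lmult_apply)
  have N: "?N \<in> sets (mat_space n p)"
  proof -
    have "?N = {X \<in> space (mat_space n p). \<forall>j\<in>{..<p}. 1 - \<epsilon> < X (j, j)}" by auto
    also have "\<dots> \<in> sets (mat_space n p)"
      by measurable (use \<open>p \<le> n\<close> in auto)
    finally show ?thesis .
  qed
  have "emeasure \<kappa> {X \<in> space (mat_space n n). \<forall>j<n. 1 - \<epsilon> < X (j, j)} \<le> emeasure \<kappa> (?f -` ?N \<inter> space \<kappa>)"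
  proof (rule emeasure_mono)
    show "?f -` ?N \<inter> space \<kappa> \<in> sets \<kappa>" by (rule measurable_sets[OF f N])
    show "{X \<in> space (mat_space n n). \<forall>j<n. 1 - \<epsilon> < X (j, j)} \<subseteq> ?f -` ?N \<inter> space \<kappa>"
      using \<open>p \<le> n\<close> by (auto simp: sp space_mat_space mat_lmult_unit_right)
  qed
  also have "\<dots> = emeasure (haar_stiefel n p) ?N"
    unfolding haar_stiefel_eq[OF invariant_prob_distr_unit[OF \<kappa> \<open>p \<le> n\<close>] \<open>p \<le> n\<close>]
    by (rule emeasure_distr[OF f N, symmetric])
  finally show ?thesis using near[OF \<open>\<epsilon> > 0\<close>] by auto
qed

section \<open>Integrability of the density\<close>

lemma stiefel_entry_le:
  assumes "X \<in> stiefel n p" "i < n" "j < p"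
  shows "\<bar>X (i, j)\<bar> \<le> 1"
proof -
  have "X (i, j) * X (i, j) \<le> (\<Sum>k<n. X (k, j) * X (k, j))"
    using assms by (intro member_le_sum) auto
  also have "\<dots> = 1" using assms by (simp add: stiefel_def)
  finally show ?thesis
    using abs_le_square_iff[of "X (i, j)" 1] by (simp add: power2_eq_square)
qed

section \<open>Exponential bounds for the hypergeometric function and the density\<close>

context
  fixes n p :: nat
  assumes p_le_n: "p \<le> n"
begin

interpretation haar: prob_space "haar_stiefel n p"
  using haar_stiefel_invariant[OF p_le_n] by (simp add: invariant_prob_def)

lemma sets_haar_stiefel [measurable_cong]: "sets (haar_stiefel n p) = sets (mat_space n p)"
  using haar_stiefel_invariant[OF p_le_n] by (simp add: invariant_prob_def)

lemma measurable_exp_trace [measurable]: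
  "(\<lambda>X. exp (\<Sum>j<p. d j * X (j, j))) \<in> borel_measurable (haar_stiefel n p)"
proof -
  have "(\<lambda>X. X (j, j)) \<in> borel_measurable (haar_stiefel n p)" if "j < p" for j
    using measurable_mat_entry[of j n j p] that p_le_n
    by (simp add: measurable_cong_sets[OF sets_haar_stiefel refl])
  then show ?thesis by measurable
qed

lemma AE_exp_trace_le:
  assumes "\<And>j. j < p \<Longrightarrow> 0 \<le> d j"
  shows "AE X in haar_stiefel n p. exp (\<Sum>j<p. d j * X (j, j)) \<le> exp (\<Sum>j<p. d j)"
  using invariant_prob_AE_stiefel[OF haar_stiefel_invariant[OF p_le_n]]
proof eventually_elim
  case (elim X)
  have "X (j, j) \<le> 1" if "j < p" for j
    using stiefel_entry_le[OF elim, of j j] that p_le_n by simp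
  then have "(\<Sum>j<p. d j * X (j, j)) \<le> (\<Sum>j<p. d j)"
    using assms by (intro sum_mono mult_left_le) auto
  then show ?case by simp
qed

lemma integrable_exp_trace:
  assumes "\<And>j. j < p \<Longrightarrow> 0 \<le> d j"
  shows "integrable (haar_stiefel n p) (\<lambda>X. exp (\<Sum>j<p. d j * X (j, j)))"
  using AE_exp_trace_le[OF assms] by (intro haar.integrable_const_bound[where B = "exp (\<Sum>j<p. d j)"]) auto

lemma hyp0F1_stiefel_upper:
  assumes "\<And>j. j < p \<Longrightarrow> 0 \<le> d j"
  shows "hyp0F1_stiefel n p d \<le> exp (\<Sum>j<p. d j)"
  unfolding hyp0F1_stiefel_def
  by (intro haar.integral_le_const integrable_exp_trace AE_exp_trace_le assms)

text \<open>The constant is the Haar mass of the matrices with all diagonal entries above 1 -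
  \<epsilon>, hence independent of \<open>d\<close>. On this set the integrand is at least the
  exponential claimed, and elsewhere it is bounded below by 0.\<close>

lemma hyp0F1_stiefel_lower:
  assumes "\<epsilon> > 0"
  obtains c where "c > 0"
    "\<And>d. (\<And>j. j < p \<Longrightarrow> 0 \<le> d j) \<Longrightarrow> c * exp ((1 - \<epsilon>) * (\<Sum>j<p. d j)) \<le> hyp0F1_stiefel n p d"
proof
  let ?H = "haar_stiefel n p"
  define N where "N = {X \<in> space (mat_space n p). \<forall>j<p. 1 - \<epsilon> < X (j, j)}"
  have nz: "emeasure ?H N \<noteq> 0"
    using haar_stiefel_near_unit[OF p_le_n assms] by (simp only: N_def not_False_eq_True)
  then show "measure ?H N > 0"
    by (simp add: haar.emeasure_eq_measure zero_less_measure_iff)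
  from nz have N: "N \<in> sets ?H" by (rule emeasure_neq_0_sets)
  fix d :: "nat \<Rightarrow> real" assume d: "\<And>j. j < p \<Longrightarrow> 0 \<le> d j"
  have "measure ?H N * exp ((1 - \<epsilon>) * (\<Sum>j<p. d j)) =
      (\<integral>X. indicator N X * exp ((1 - \<epsilon>) * (\<Sum>j<p. d j)) \<partial>?H)"
    using N by simp
  also have "\<dots> \<le> hyp0F1_stiefel n p d"
    unfolding hyp0F1_stiefel_def
  proof (rule integral_mono)
    show "integrable ?H (\<lambda>X. indicator N X * exp ((1 - \<epsilon>) * (\<Sum>j<p. d j)))"
      using N by (intro integrable_mult_left integrable_real_indicator) (auto simp: haar.emeasure_eq_measure)
    show "integrable ?H (\<lambda>X. exp (\<Sum>j<p. d j * X (j, j)))"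
      using d by (rule integrable_exp_trace)
    fix X
    show "indicator N X * exp ((1 - \<epsilon>) * (\<Sum>j<p. d j)) \<le> exp (\<Sum>j<p. d j * X (j, j))"
    proof (cases "X \<in> N")
      case True
      have "(1 - \<epsilon>) * (\<Sum>j<p. d j) \<le> (\<Sum>j<p. d j * X (j, j))"
        unfolding sum_distrib_left
      proof (rule sum_mono)
        fix j assume "j \<in> {..<p}"
        then show "(1 - \<epsilon>) * d j \<le> d j * X (j, j)"
          using True d[of j] mult_left_mono[of "1 - \<epsilon>" "X (j, j)" "d j"]
          by (simp add: N_def mult.commute less_imp_le)
      qed
      with True show ?thesis by simp
    qed simp
  qed
  finally show "measure ?H N * exp ((1 - \<epsilon>) * (\<Sum>j<p. d j)) \<le> hyp0F1_stiefel n p d" .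
qed

lemma hyp0F1_stiefel_pos:
  assumes "\<And>j. j < p \<Longrightarrow> 0 \<le> d j"
  shows "hyp0F1_stiefel n p d > 0"
proof -
  \<comment> \<open>For \<epsilon> = 1 the exponential factor is 1 and the lower bound is the
    positive constant \<open>c\<close>.\<close>
  obtain c where "c > 0"
    and c: "\<And>d. (\<And>j. j < p \<Longrightarrow> 0 \<le> d j) \<Longrightarrow> c * exp ((1 - 1) * (\<Sum>j<p. d j)) \<le> hyp0F1_stiefel n p d"
    using hyp0F1_stiefel_lower[OF zero_less_one] by blast
  have "c * exp ((1 - 1) * (\<Sum>j<p. d j)) \<le> hyp0F1_stiefel n p d"
    using assms by (rule c)
  with \<open>c > 0\<close> show ?thesis by simp
qed

text \<open>The upper bound for 0F1 is raised to the power \<nu> and put into the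
  denominator.\<close>

lemma g_dens_lower:
  assumes "\<nu> > 0" and d: "\<And>j. j < p \<Longrightarrow> 0 \<le> d j"
  shows "exp (\<nu> * (\<Sum>j<p. (\<eta> j - 1) * d j)) \<le> g_dens n p \<nu> \<eta> d"
proof -
  have F: "hyp0F1_stiefel n p d > 0" using d by (rule hyp0F1_stiefel_pos)
  have "hyp0F1_stiefel n p d powr \<nu> \<le> exp (\<Sum>j<p. d j) powr \<nu>"
    using F hyp0F1_stiefel_upper[of d] d \<open>\<nu> > 0\<close> by (intro powr_mono2) auto
  then have "exp (\<nu> * (\<Sum>j<p. \<eta> j * d j)) / exp (\<nu> * (\<Sum>j<p. d j)) \<le> g_dens n p \<nu> \<eta> d"
    unfolding g_dens_def using F
    by (intro divide_left_mono) (auto simp: exp_powr_real mult.commute)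
  then show ?thesis
    by (simp add: exp_diff[symmetric] left_diff_distrib sum_subtractf right_diff_distrib)
qed

text \<open>The lower bound \<open>c * exp ((1 - \<epsilon>) * ...)\<close> for 0F1 enters the
  denominator, so \<open>C\<close> is 1 / c^\<nu>, the same for all \<open>d\<close>.\<close>

lemma g_dens_upper:
  assumes "\<nu> > 0" "\<epsilon> > 0"
  obtains C where "C > 0"
    "\<And>d. (\<And>j. j < p \<Longrightarrow> 0 \<le> d j) \<Longrightarrow> g_dens n p \<nu> \<eta> d \<le> C * exp (\<nu> * (\<Sum>j<p. (\<eta> j - (1 - \<epsilon>)) * d j))"
proof -
  obtain c where c: "c > 0"
    "\<And>d. (\<And>j. j < p \<Longrightarrow> 0 \<le> d j) \<Longrightarrow> c * exp ((1 - \<epsilon>) * (\<Sum>j<p. d j)) \<le> hyp0F1_stiefel n p d"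
    using hyp0F1_stiefel_lower[OF \<open>\<epsilon> > 0\<close>] by blast
  have "g_dens n p \<nu> \<eta> d \<le> 1 / c powr \<nu> * exp (\<nu> * (\<Sum>j<p. (\<eta> j - (1 - \<epsilon>)) * d j))"
    if d: "\<And>j. j < p \<Longrightarrow> 0 \<le> d j" for d
  proof -
    have F: "hyp0F1_stiefel n p d > 0" using d by (rule hyp0F1_stiefel_pos)
    have "(c * exp ((1 - \<epsilon>) * (\<Sum>j<p. d j))) powr \<nu> \<le> hyp0F1_stiefel n p d powr \<nu>"
      using c d \<open>\<nu> > 0\<close> by (intro powr_mono2) auto
    then have "g_dens n p \<nu> \<eta> d \<le>
        exp (\<nu> * (\<Sum>j<p. \<eta> j * d j)) / (c * exp ((1 - \<epsilon>) * (\<Sum>j<p. d j))) powr \<nu>"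
      unfolding g_dens_def using c(1) F by (intro divide_left_mono) auto
    also have "(c * exp ((1 - \<epsilon>) * (\<Sum>j<p. d j))) powr \<nu> =
        c powr \<nu> * exp (\<nu> * ((1 - \<epsilon>) * (\<Sum>j<p. d j)))"
      using c(1) by (simp add: powr_mult exp_powr_real mult.commute)
    also have "exp (\<nu> * (\<Sum>j<p. \<eta> j * d j)) / \<dots> =
        1 / c powr \<nu> * exp (\<nu> * (\<Sum>j<p. \<eta> j * d j) - \<nu> * ((1 - \<epsilon>) * (\<Sum>j<p. d j)))"
      by (simp add: exp_diff)
    also have "\<nu> * (\<Sum>j<p. \<eta> j * d j) - \<nu> * ((1 - \<epsilon>) * (\<Sum>j<p. d j)) =
        \<nu> * (\<Sum>j<p. (\<eta> j - (1 - \<epsilon>)) * d j)"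
      unfolding left_diff_distrib[of "\<eta> _"] sum_subtractf sum_distrib_left[symmetric] right_diff_distrib[of \<nu>] ..
    finally show ?thesis .
  qed
  moreover have "1 / c powr \<nu> > 0" using c(1) by simp
  ultimately show thesis using that by blast
qed

end

section \<open>One-dimensional integrals and integration over the orthant\<close>

lemma nn_integral_exp_neg_finite:
  assumes "a > (0::real)"
  shows "(\<integral>\<^sup>+x. ennreal (exp (- a * x)) * indicator {0<..} x \<partial>lborel) < \<infinity>"
proof -
  have "(\<integral>\<^sup>+x. ennreal (exp (- a * x)) * indicator {0<..} x \<partial>lborel) \<le>
      (\<integral>\<^sup>+x. ennreal (exp (- a * x)) * indicator {0..} x \<partial>lborel)"
    by (intro nn_integral_mono) (auto simp: indicator_def)
  also have "\<dots> = ennreal (0 - (- exp (- a * 0) / a))"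
  proof (rule nn_integral_FTC_atLeast)
    show "((\<lambda>x. - exp (- a * x) / a) has_real_derivative exp (- a * x)) (at x)" for x
      using assms by (auto intro!: derivative_eq_intros)
    show "((\<lambda>x. - exp (- a * x) / a) \<longlongrightarrow> 0) at_top"
      using assms by real_asymp
  qed auto
  finally show ?thesis by (auto simp: less_top[symmetric] top_unique)
qed

lemma emeasure_lborel_greaterThan: "emeasure lborel {a::real<..} = \<infinity>"
proof (rule ccontr)
  assume "emeasure lborel {a<..} \<noteq> \<infinity>"
  then obtain r where r: "emeasure lborel {a<..} = ennreal r" "r \<ge> 0"
    by (cases "emeasure lborel {a<..}") auto
  have "emeasure lborel {a<..<a + (r + 1)} \<le> emeasure lborel {a<..}"
    by (rule emeasure_mono) auto
  then show False using r by simp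
qed

theorem theorem2:
  fixes n p :: nat and \<nu> :: real and \<eta> :: "nat \<Rightarrow> real"
  assumes "1 \<le> p" and "p \<le> n" and "\<nu> > 0"
  shows "((\<integral>\<^sup>+ d. ennreal (g_dens n p \<nu> \<eta> d) * indicator (pos_orthant p) d
             \<partial>PiM {..<p} (\<lambda>_. lborel)) < \<infinity>)
         \<longleftrightarrow> (Max (\<eta> ` {..<p}) < 1)"
    (is "?I < \<infinity> \<longleftrightarrow> _")
proof
  have ne: "\<eta> ` {..<p} \<noteq> {}" using \<open>1 \<le> p\<close> by (auto simp: lessThan_empty_iff)
  assume "Max (\<eta> ` {..<p}) < 1"
  \<comment> \<open>Half the gap below 1: every 1 - \<epsilon> - \<eta>_j is then at least
    \<epsilon>, so each decay rate \<open>a j\<close> is positive.\<close>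
  define \<epsilon> where "\<epsilon> = (1 - Max (\<eta> ` {..<p})) / 2"
  have "\<epsilon> > 0" using \<open>Max (\<eta> ` {..<p}) < 1\<close> by (simp add: \<epsilon>_def)
  define a where "a j = \<nu> * (1 - \<epsilon> - \<eta> j)" for j
  have a_pos: "a j > 0" if "j < p" for j
  proof -
    have "\<eta> j \<le> Max (\<eta> ` {..<p})" using that by (intro Max_ge) auto
    then have "1 - \<epsilon> - \<eta> j > 0"
      using \<open>Max (\<eta> ` {..<p}) < 1\<close> by (simp add: \<epsilon>_def field_simps)
    then show ?thesis using \<open>\<nu> > 0\<close> by (simp add: a_def)
  qed
  obtain C where "C > 0" and C: "\<And>d. (\<And>j. j < p \<Longrightarrow> 0 \<le> d j) \<Longrightarrow>
      g_dens n p \<nu> \<eta> d \<le> C * exp (\<nu> * (\<Sum>j<p. (\<eta> j - (1 - \<epsilon>)) * d j))"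
    using g_dens_upper[OF \<open>p \<le> n\<close> \<open>\<nu> > 0\<close> \<open>\<epsilon> > 0\<close>] by blast
  let ?h = "\<lambda>j x. ennreal (exp (- a j * x)) * indicator {0<..} x"
  \<comment> \<open>The dominating function is a product of functions of single coordinates, and its
    integral factors into convergent exponential integrals.\<close>
  have "?I \<le> (\<integral>\<^sup>+ d. ennreal C * (\<Prod>j\<in>{..<p}. ?h j (d j)) \<partial>PiM {..<p} (\<lambda>_. lborel))"
  proof (rule nn_integral_mono)
    fix d
    show "ennreal (g_dens n p \<nu> \<eta> d) * indicator (pos_orthant p) d \<le> ennreal C * (\<Prod>j\<in>{..<p}. ?h j (d j))"
    proof (cases "d \<in> pos_orthant p")
      case True
      then have d: "\<And>j. j < p \<Longrightarrow> 0 < d j" by (auto simp: pos_orthant_def PiE_iff)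
      have "\<nu> * (\<Sum>j<p. (\<eta> j - (1 - \<epsilon>)) * d j) = (\<Sum>j<p. - a j * d j)"
        by (simp add: a_def sum_distrib_left algebra_simps)
      then have "g_dens n p \<nu> \<eta> d \<le> C * (\<Prod>j\<in>{..<p}. exp (- a j * d j))"
        using C[of d] d by (simp add: less_imp_le exp_sum)
      then have "ennreal (g_dens n p \<nu> \<eta> d) \<le> ennreal C * (\<Prod>j\<in>{..<p}. ennreal (exp (- a j * d j)))"
        using \<open>C > 0\<close> by (subst prod_ennreal) (auto simp: ennreal_mult[symmetric] prod_nonneg intro: ennreal_leI)
      also have "(\<Prod>j\<in>{..<p}. ennreal (exp (- a j * d j))) = (\<Prod>j\<in>{..<p}. ?h j (d j))"
        using d by (intro prod.cong) auto
      finally show ?thesis using True by simp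
    qed simp
  qed
  also have "\<dots> = ennreal C * (\<integral>\<^sup>+ d. (\<Prod>j\<in>{..<p}. ?h j (d j)) \<partial>PiM {..<p} (\<lambda>_. lborel))"
  proof (intro nn_integral_cmult borel_measurable_prod_ennreal)
    fix j assume "j \<in> {..<p}"
    then show "(\<lambda>d. ?h j (d j)) \<in> borel_measurable (PiM {..<p} (\<lambda>_. lborel))"
      by (intro measurable_compose[OF measurable_component_singleton]) auto
  qed
  also have "(\<integral>\<^sup>+ d. (\<Prod>j\<in>{..<p}. ?h j (d j)) \<partial>PiM {..<p} (\<lambda>_. lborel)) =
      (\<Prod>j\<in>{..<p}. \<integral>\<^sup>+x. ?h j x \<partial>lborel)"
    by (rule lborel_product.product_nn_integral_prod) auto
  also have "ennreal C * \<dots> < \<infinity>"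
    using nn_integral_exp_neg_finite[OF a_pos]
    by (auto simp: ennreal_mult_eq_top_iff ennreal_prod_eq_top less_top[symmetric])
  finally show "?I < \<infinity>" .
next
  assume fin: "?I < \<infinity>"
  show "Max (\<eta> ` {..<p}) < 1"
  proof (rule ccontr)
    assume "\<not> Max (\<eta> ` {..<p}) < 1"
    moreover have "Max (\<eta> ` {..<p}) \<in> \<eta> ` {..<p}"
      using \<open>1 \<le> p\<close> by (intro Max_in) (auto simp: lessThan_empty_iff)
    ultimately obtain k where k: "k < p" "\<eta> k \<ge> 1" by force
    \<comment> \<open>The lower bound of the density on the box below: direction k contributes a
      nonnegative exponent because \<eta>_k \<ge> 1, and each other coordinate, lying in (0, 1),
      lowers the exponent by at most \<nu> |\<eta>_j - 1|.\<close>
    define C where "C = exp (- (\<nu> * (\<Sum>j<p. \<bar>\<eta> j - 1\<bar>)))"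
    \<comment> \<open>The box is unbounded in direction k only and has unit length in every other
      direction, so its volume is infinite.\<close>
    define S :: "nat \<Rightarrow> real set" where "S j = (if j = k then {0<..} else {0<..<1})" for j
    have S: "S j \<in> sets borel" for j by (simp add: S_def)
    have box: "PiE {..<p} S \<in> sets (PiM {..<p} (\<lambda>_. lborel))"
      using S by (intro sets_PiM_I_finite) auto
    have "(\<integral>\<^sup>+ d. ennreal C * indicator (PiE {..<p} S) d \<partial>PiM {..<p} (\<lambda>_. lborel)) \<le> ?I"
    proof (rule nn_integral_mono)
      fix d
      show "ennreal C * indicator (PiE {..<p} S) d \<le> ennreal (g_dens n p \<nu> \<eta> d) * indicator (pos_orthant p) d"
      proof (cases "d \<in> PiE {..<p} S")
        case True
        then have dS: "d j \<in> S j" if "j < p" for j using that by auto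
        then have d_pos: "d j > 0" if "j < p" for j
          using that by (fastforce simp: S_def split: if_splits)
        have "- \<bar>\<eta> j - 1\<bar> \<le> (\<eta> j - 1) * d j" if "j < p" for j
        proof (cases "j = k")
          case True
          then have "0 \<le> (\<eta> j - 1) * d j" using k d_pos[OF that] by simp
          then show ?thesis by linarith
        next
          case False
          then have "\<bar>d j\<bar> \<le> 1" using dS[OF that] by (simp add: S_def)
          then have "\<bar>(\<eta> j - 1) * d j\<bar> \<le> \<bar>\<eta> j - 1\<bar>"
            by (simp add: abs_mult mult_left_le)
          then show ?thesis by linarith
        qed
        then have "(\<Sum>j<p. - \<bar>\<eta> j - 1\<bar>) \<le> (\<Sum>j<p. (\<eta> j - 1) * d j)"
          by (intro sum_mono) auto
        then have "\<nu> * (\<Sum>j<p. - \<bar>\<eta> j - 1\<bar>) \<le> \<nu> * (\<Sum>j<p. (\<eta> j - 1) * d j)"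
          using \<open>\<nu> > 0\<close> by (intro mult_left_mono) auto
        then have "C \<le> exp (\<nu> * (\<Sum>j<p. (\<eta> j - 1) * d j))"
          by (simp add: C_def sum_negf)
        also have "\<dots> \<le> g_dens n p \<nu> \<eta> d"
          using d_pos by (intro g_dens_lower \<open>p \<le> n\<close> \<open>\<nu> > 0\<close>) (auto intro: less_imp_le)
        finally have "C \<le> g_dens n p \<nu> \<eta> d" .
        moreover have "d \<in> pos_orthant p"
          using True d_pos by (auto simp: pos_orthant_def PiE_iff)
        ultimately show ?thesis using True by (simp add: ennreal_leI)
      qed simp
    qed
    also have "(\<integral>\<^sup>+ d. ennreal C * indicator (PiE {..<p} S) d \<partial>PiM {..<p} (\<lambda>_. lborel)) =
        ennreal C * (\<Prod>j<p. emeasure lborel (S j))"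
      using box S by (simp add: nn_integral_cmult_indicator lborel_product.emeasure_PiM)
    also have "(\<Prod>j<p. emeasure lborel (S j)) = emeasure lborel (S k) * (\<Prod>j\<in>{..<p} - {k}. emeasure lborel (S j))"
      using k by (intro prod.remove) auto
    also have "(\<Prod>j\<in>{..<p} - {k}. emeasure lborel (S j)) = 1"
      by (intro prod.neutral) (auto simp: S_def)
    also have "emeasure lborel (S k) = \<infinity>"
      by (simp add: S_def emeasure_lborel_greaterThan)
    finally have "?I = \<infinity>" by (simp add: C_def ennreal_mult_top top_unique)
    with fin show False by simp
  qed
qed

end
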